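(* Let $B$ be a semi-Boolean restriction semigroup with projections $P$. Then the ultrafilters $\mathcal U(B)$ form a Hausdorff ample semicategory. The source unit of any $U\in\mathcal U(B)$ is given by $\mathsf s(U)=U^{\mathsf S\leq}$, while $U$ has a range unit precisely when $U^{\mathsf R}\neq\emptyset$, in which case $\mathsf r(U)=U^{\mathsf R\leq}$.
   Context: **Restriction semigroups.** Let $B$ be a semigroup with a distinguished commutative subsemigroup $P$ of idempotents ("projections"). Write $a\leq b$ iff $a=bp$ for some $p\in P$; $\mathsf s(a)=\min\{p\in P:ap=a\}$ if it exists. $B$ is a restriction semigroup relative to $P$ if every element has a source projection $\mathsf s(a)$ (then $\leq$ is a partial order), $\mathsf s(ab)=\mathsf s(\mathsf s(a)b)$ for all $a,b\in B$, and $pb\leq b$ for all $p\in P$, $b\in B$. **Semi-Boolean.** A poset is a semi-Boolean algebra if every pair of elements has a meet and every principal ideal $\{c:c\leq b\}$ is a Boolean algebra. (Then it has a minimum and every pair with an upper bound has a join.) A semi-Boolean restriction semigroup is a restriction semigroup $B$ with an element $0\in P$ satisfying $0b=0$ for all $b\in B$ (then $0$ is also a right zero and the minimum of $B$), such that $(B,\leq)$ is a semi-Boolean algebra and $(a\vee b)c=ac\vee bc$ for all $a,b,c\in B$ with $a,b$ having an upper bound. **Ultrafilters.** A filter in the poset $B$ is a non-empty up-set $F$ such that any $a,b\in F$ have a common lower bound in $F$; it is proper if $F\neq B$; an ultrafilter is a maximal proper filter. $\mathcal U(B)$ is the set of ultrafilters with the topology having basis $O_b=\{U\in\mathcal U(B):b\in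 U\}$, $b\in B$. For $T\subseteq B$, $T^{\leq}=\{c\in B:\exists t\in T,\ t\leq c\}$. The partial product is $V\cdot W=(VW)^{\leq}$, where $VW=\{vw:v\in V,w\in W\}$, defined precisely when $0\notin VW$. For $U\subseteq B$: $U^{\mathsf S}=\{p\in P:ap=a\text{ for some }a\in U\}$, $U^{\mathsf R}=\{p\in P:pa=a\text{ for some }a\in U\}$, $U^{\mathsf S\leq}=(U^{\mathsf S})^{\leq}$, $U^{\mathsf R\leq}=(U^{\mathsf R})^{\leq}$. **Semicategories.** A semigroupoid is a set $S$ with a product defined on some pairs $S^2\subseteq S\times S$ such that $(ab)c$ is defined iff $a(bc)$ is defined, in which case they are equal. Its units are $S^0=\{u\in S:\forall a\in S\ [(u,a)\in S^2\Rightarrow ua=a]\text{ and }[(a,u)\in S^2\Rightarrow au=a]\}$. The source unit $\mathsf s(a)$ is the (unique, if it exists) $u\in S^0$ with $(a,u)\in S^2$; the range unit $\mathsf r(a)$ is the (unique, if it exists) $u\in S^0$ with $(u,a)\in S^2$. $S$ is a semicategory if every $a\in S$ has a source unit and $S^2=\{(a,b):\mathsf r(b)\text{ exists and }\mathsf s(a)=\mathsf r(b)\}$. $S^0S$ is the set of elements having a range unit. **Ample.** A semicategory with a topology is topological if $\mathsf s$ (on $S$), $\mathsf r$ (on $S^0S$) and the product (on $S^2$) are continuous. It is étale if it is topological, $S^0S$ is open in $S$ and $\mathsf s$ is a locally injective open map. It is ample if it is étale, $S^2$ is closed in $S\times S$, and the compact open subsets form a basis of the topology. *)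

theory Defs
  imports "HOL-Analysis.Analysis" "HOL-Algebra.Lattice"
begin

section \<open>Restriction semigroups\<close>

definition restr_order :: "'a::semigroup_mult set \<Rightarrow> 'a gorder" where
  "restr_order P = \<lparr>carrier = UNIV, eq = (=), le = (\<lambda>a b. \<exists>p\<in>P. a = b * p)\<rparr>"

definition is_source_proj :: "'a::semigroup_mult set \<Rightarrow> 'a \<Rightarrow> 'a \<Rightarrow> bool" where
  "is_source_proj P a p \<longleftrightarrow> least (restr_order P) p {p \<in> P. a * p = a}"

definition source_proj :: "'a::semigroup_mult set \<Rightarrow> 'a \<Rightarrow> 'a" where
  "source_proj P a = (THE p. is_source_proj P a p)"

locale restriction_semigroup =
  fixes P :: "'a::semigroup_mult set"
  assumes proj_closed: "\<lbrakk>p \<in> P; q \<in> P\<rbrakk> \<Longrightarrow> p * q \<in> P"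
    and proj_commute: "\<lbrakk>p \<in> P; q \<in> P\<rbrakk> \<Longrightarrow> p * q = q * p"
    and proj_idem: "p \<in> P \<Longrightarrow> p * p = p"
    and source_proj_exists: "\<exists>p. is_source_proj P a p"
    and source_proj_mult: "source_proj P (a * b) = source_proj P (source_proj P a * b)"
    and proj_mult_le: "p \<in> P \<Longrightarrow> p * b \<sqsubseteq>\<^bsub>restr_order P\<^esub> b"


section \<open>Semi-Boolean restriction semigroups\<close>

locale boolean_lattice = bounded_lattice +
  assumes meet_join_distrib:
      "\<lbrakk>x \<in> carrier L; y \<in> carrier L; z \<in> carrier L\<rbrakk>
        \<Longrightarrow> x \<sqinter> (y \<squnion> z) = (x \<sqinter> y) \<squnion> (x \<sqinter> z)"
    and complement_exists:
      "x \<in> carrier L \<Longrightarrow> \<exists>y\<in>carrier L. x \<sqinter> y = \<bottom> \<and> x \<squnion> y = \<top>"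

locale semi_boolean_algebra = lower_semilattice +
  assumes principal_ideal_boolean:
    "b \<in> carrier L \<Longrightarrow> boolean_lattice (L\<lparr>carrier := {c \<in> carrier L. c \<sqsubseteq> b}\<rparr>)"

text \<open>
  The sort \<open>zero\<close> only provides a constant \<open>0\<close>; its properties are the locale assumptions.
\<close>

locale semi_boolean_restriction_semigroup = restriction_semigroup P
  for P :: "'a::{semigroup_mult, zero} set" +
  assumes zero_proj: "0 \<in> P"
    and zero_mult: "0 * b = 0"
    and semi_boolean: "semi_boolean_algebra (restr_order P)"
    and join_mult:
      "\<exists>u. a \<sqsubseteq>\<^bsub>restr_order P\<^esub> u \<and> b \<sqsubseteq>\<^bsub>restr_order P\<^esub> u
        \<Longrightarrow> (a \<squnion>\<^bsub>restr_order P\<^esub> b) * c = (a * c) \<squnion>\<^bsub>restr_order P\<^esub> (b * c)"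


section \<open>Ultrafilters\<close>

definition up_closure :: "('a, 'm) gorder_scheme \<Rightarrow> 'a set \<Rightarrow> 'a set" where
  "up_closure L T = {c \<in> carrier L. \<exists>t\<in>T. t \<sqsubseteq>\<^bsub>L\<^esub> c}"

definition order_filter :: "('a, 'm) gorder_scheme \<Rightarrow> 'a set \<Rightarrow> bool" where
  "order_filter L F \<longleftrightarrow>
     F \<noteq> {} \<and> F \<subseteq> carrier L \<and>
     (\<forall>a\<in>F. \<forall>b\<in>carrier L. a \<sqsubseteq>\<^bsub>L\<^esub> b \<longrightarrow> b \<in> F) \<and>
     (\<forall>a\<in>F. \<forall>b\<in>F. \<exists>c\<in>F. c \<sqsubseteq>\<^bsub>L\<^esub> a \<and> c \<sqsubseteq>\<^bsub>L\<^esub> b)"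

definition proper_order_filter :: "('a, 'm) gorder_scheme \<Rightarrow> 'a set \<Rightarrow> bool" where
  "proper_order_filter L F \<longleftrightarrow> order_filter L F \<and> F \<noteq> carrier L"

definition ultrafilters :: "('a, 'm) gorder_scheme \<Rightarrow> 'a set set" where
  "ultrafilters L =
     {U. proper_order_filter L U \<and> (\<forall>F. proper_order_filter L F \<and> U \<subseteq> F \<longrightarrow> F = U)}"

definition basic_ultrafilters :: "('a, 'm) gorder_scheme \<Rightarrow> 'a \<Rightarrow> 'a set set" where
  "basic_ultrafilters L b = {U \<in> ultrafilters L. b \<in> U}"

definition ultrafilter_topology :: "('a, 'm) gorder_scheme \<Rightarrow> 'a set topology" where
  "ultrafilter_topology L =
     topology (arbitrary union_of (\<lambda>W. \<exists>b\<in>carrier L. W = basic_ultrafilters L b))"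

lemma openin_ultrafilter_topology:
  "openin (ultrafilter_topology L) =
     arbitrary union_of (\<lambda>W. \<exists>b\<in>carrier L. W = basic_ultrafilters L b)"
proof -
  have "(arbitrary union_of (\<lambda>W. \<exists>b\<in>carrier L. W = basic_ultrafilters L b))
          (basic_ultrafilters L a \<inter> basic_ultrafilters L b)"
    if "a \<in> carrier L" "b \<in> carrier L" for a b
  proof -
    let ?D = "{d \<in> carrier L. d \<sqsubseteq>\<^bsub>L\<^esub> a \<and> d \<sqsubseteq>\<^bsub>L\<^esub> b}"
    have "basic_ultrafilters L a \<inter> basic_ultrafilters L b = \<Union> (basic_ultrafilters L ` ?D)"
    proof
      show "basic_ultrafilters L a \<inter> basic_ultrafilters L b \<subseteq> \<Union> (basic_ultrafilters L ` ?D)"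
      proof
        fix U assume "U \<in> basic_ultrafilters L a \<inter> basic_ultrafilters L b"
        then have U: "U \<in> ultrafilters L" "a \<in> U" "b \<in> U"
          by (auto simp: basic_ultrafilters_def)
        then have "order_filter L U"
          by (simp add: ultrafilters_def proper_order_filter_def)
        then obtain c where "c \<in> U" "c \<in> carrier L" "c \<sqsubseteq>\<^bsub>L\<^esub> a" "c \<sqsubseteq>\<^bsub>L\<^esub> b"
          using U unfolding order_filter_def by blast
        then show "U \<in> \<Union> (basic_ultrafilters L ` ?D)"
          using U by (auto simp: basic_ultrafilters_def)
      qed
      show "\<Union> (basic_ultrafilters L ` ?D) \<subseteq> basic_ultrafilters L a \<inter> basic_ultrafilters L b"
      proof
        fix U assume "U \<in> \<Union> (basic_ultrafilters L ` ?D)"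
        then obtain d where d: "d \<sqsubseteq>\<^bsub>L\<^esub> a" "d \<sqsubseteq>\<^bsub>L\<^esub> b" "U \<in> ultrafilters L" "d \<in> U"
          unfolding basic_ultrafilters_def by blast
        then have "order_filter L U"
          by (simp add: ultrafilters_def proper_order_filter_def)
        then have "a \<in> U" "b \<in> U"
          using d that unfolding order_filter_def by blast+
        then show "U \<in> basic_ultrafilters L a \<inter> basic_ultrafilters L b"
          using d(3) by (simp add: basic_ultrafilters_def)
      qed
    qed
    moreover have "basic_ultrafilters L ` ?D
        \<subseteq> Collect (\<lambda>W. \<exists>b\<in>carrier L. W = basic_ultrafilters L b)"
      by blast
    ultimately show ?thesis
      unfolding union_of_def arbitrary_def by (intro exI[of _ "basic_ultrafilters L ` ?D"]) simp
  qed
  then have "istopology (arbitrary union_of (\<lambda>W. \<exists>b\<in>carrier L. W = basic_ultrafilters L b))"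
    unfolding istopology_base_eq by (safe; simp)
  then show ?thesis
    unfolding ultrafilter_topology_def by (rule topology_inverse')
qed

lemma topspace_ultrafilter_topology [simp]:
  "topspace (ultrafilter_topology L) = ultrafilters L"
proof
  have "(arbitrary union_of (\<lambda>W. \<exists>b\<in>carrier L. W = basic_ultrafilters L b))
          (topspace (ultrafilter_topology L))"
    using openin_topspace[of "ultrafilter_topology L"] by (simp only: openin_ultrafilter_topology)
  then obtain C where C: "C \<subseteq> Collect (\<lambda>W. \<exists>b\<in>carrier L. W = basic_ultrafilters L b)"
    "\<Union> C = topspace (ultrafilter_topology L)"
    unfolding union_of_def by (elim exE conjE) (rule that, assumption+)
  have "W \<subseteq> ultrafilters L" if "W \<in> C" for W
  proof -
    from that C(1) obtain b where "W = basic_ultrafilters L b" by blast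
    then show ?thesis by (simp add: basic_ultrafilters_def)
  qed
  then show "topspace (ultrafilter_topology L) \<subseteq> ultrafilters L"
    using C(2) by blast
  show "ultrafilters L \<subseteq> topspace (ultrafilter_topology L)"
  proof
    fix U assume U: "U \<in> ultrafilters L"
    then have "order_filter L U"
      by (simp add: ultrafilters_def proper_order_filter_def)
    then obtain b where "b \<in> U" "b \<in> carrier L"
      unfolding order_filter_def by blast
    then have "openin (ultrafilter_topology L) (basic_ultrafilters L b)"
      unfolding openin_ultrafilter_topology by (intro arbitrary_union_of_inc) blast
    then have "basic_ultrafilters L b \<subseteq> topspace (ultrafilter_topology L)"
      by (rule openin_subset)
    then show "U \<in> topspace (ultrafilter_topology L)"
      using U \<open>b \<in> U\<close> unfolding basic_ultrafilters_def by blast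
  qed
qed

definition source_set :: "'a::semigroup_mult set \<Rightarrow> 'a set \<Rightarrow> 'a set" where
  "source_set P U = {p \<in> P. \<exists>a\<in>U. a * p = a}"

definition range_set :: "'a::semigroup_mult set \<Rightarrow> 'a set \<Rightarrow> 'a set" where
  "range_set P U = {p \<in> P. \<exists>a\<in>U. p * a = a}"


section \<open>Semicategories\<close>

record 'a partial_magma = "'a partial_object" +
  composable :: "('a \<times> 'a) set"
  pprod :: "'a \<Rightarrow> 'a \<Rightarrow> 'a" (infixl \<open>\<cdot>\<index>\<close> 70)

locale semigroupoid =
  fixes S :: "('a, 'm) partial_magma_scheme" (structure)
  assumes composable_carrier: "composable S \<subseteq> carrier S \<times> carrier S"
    and comp_closed: "(a, b) \<in> composable S \<Longrightarrow> a \<cdot> b \<in> carrier S"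
    and assoc_defined:
      "\<lbrakk>a \<in> carrier S; b \<in> carrier S; c \<in> carrier S\<rbrakk> \<Longrightarrow>
        ((a, b) \<in> composable S \<and> (a \<cdot> b, c) \<in> composable S) \<longleftrightarrow>
        ((b, c) \<in> composable S \<and> (a, b \<cdot> c) \<in> composable S)"
    and assoc:
      "\<lbrakk>(a, b) \<in> composable S; (a \<cdot> b, c) \<in> composable S\<rbrakk>
        \<Longrightarrow> (a \<cdot> b) \<cdot> c = a \<cdot> (b \<cdot> c)"

definition unit_set :: "('a, 'm) partial_magma_scheme \<Rightarrow> 'a set" where
  "unit_set S =
     {u \<in> carrier S. \<forall>a\<in>carrier S.
        ((u, a) \<in> composable S \<longrightarrow> u \<cdot>\<^bsub>S\<^esub> a = a) \<and>
        ((a, u) \<in> composable S \<longrightarrow> a \<cdot>\<^bsub>S\<^esub> u = a)}"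

definition has_source_unit :: "('a, 'm) partial_magma_scheme \<Rightarrow> 'a \<Rightarrow> bool" where
  "has_source_unit S a \<longleftrightarrow> (\<exists>u\<in>unit_set S. (a, u) \<in> composable S)"

definition source_unit :: "('a, 'm) partial_magma_scheme \<Rightarrow> 'a \<Rightarrow> 'a" where
  "source_unit S a = (THE u. u \<in> unit_set S \<and> (a, u) \<in> composable S)"

definition has_range_unit :: "('a, 'm) partial_magma_scheme \<Rightarrow> 'a \<Rightarrow> bool" where
  "has_range_unit S a \<longleftrightarrow> (\<exists>u\<in>unit_set S. (u, a) \<in> composable S)"

definition range_unit :: "('a, 'm) partial_magma_scheme \<Rightarrow> 'a \<Rightarrow> 'a" where
  "range_unit S a = (THE u. u \<in> unit_set S \<and> (u, a) \<in> composable S)"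

lemma (in semigroupoid) source_unit_unique:
  assumes "u \<in> unit_set S" "(a, u) \<in> composable S" "v \<in> unit_set S" "(a, v) \<in> composable S"
  shows "u = v"
proof -
  have c: "a \<in> carrier S" "u \<in> carrier S" "v \<in> carrier S"
    using assms composable_carrier by auto
  have "a \<cdot> u = a"
    using assms c by (auto simp: unit_set_def)
  then have "(u, v) \<in> composable S"
    using assoc_defined[of a u v] assms c by simp
  then have "u \<cdot> v = v" "u \<cdot> v = u"
    using assms c by (auto simp: unit_set_def)
  then show ?thesis by simp
qed

lemma (in semigroupoid) range_unit_unique:
  assumes "u \<in> unit_set S" "(u, a) \<in> composable S" "v \<in> unit_set S" "(v, a) \<in> composable S"
  shows "u = v"
proof -
  have c: "a \<in> carrier S" "u \<in> carrier S" "v \<in> carrier S"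
    using assms composable_carrier by auto
  have "v \<cdot> a = a"
    using assms c by (auto simp: unit_set_def)
  then have "(u, v) \<in> composable S"
    using assoc_defined[of u v a] assms c by simp
  then have "u \<cdot> v = v" "u \<cdot> v = u"
    using assms c by (auto simp: unit_set_def)
  then show ?thesis by simp
qed

definition ranged_elements :: "('a, 'm) partial_magma_scheme \<Rightarrow> 'a set" where
  "ranged_elements S = {a \<in> carrier S. has_range_unit S a}"

locale semicategory = semigroupoid +
  assumes source_unit_exists: "a \<in> carrier S \<Longrightarrow> has_source_unit S a"
    and composable_eq:
      "composable S =
        {(a, b) \<in> carrier S \<times> carrier S. has_range_unit S b \<and> source_unit S a = range_unit S b}"

locale topological_semicategory = semicategory S
  for S :: "('a, 'm) partial_magma_scheme" (structure) +
  fixes X :: "'a topology"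
  assumes topspace_eq: "topspace X = carrier S"
    and continuous_source: "continuous_map X X (source_unit S)"
    and continuous_range:
      "continuous_map (subtopology X (ranged_elements S)) X (range_unit S)"
    and continuous_comp:
      "continuous_map (subtopology (prod_topology X X) (composable S)) X (\<lambda>(a, b). a \<cdot> b)"

locale etale_semicategory = topological_semicategory +
  assumes openin_ranged: "openin X (ranged_elements S)"
    and locally_injective_source:
      "a \<in> carrier S \<Longrightarrow> \<exists>W. openin X W \<and> a \<in> W \<and> inj_on (source_unit S) W"
    and open_source: "open_map X X (source_unit S)"

locale ample_semicategory = etale_semicategory +
  assumes closedin_composable: "closedin (prod_topology X X) (composable S)"
    and compact_open_base:
      "openin X = arbitrary union_of (\<lambda>K. compactin X K \<and> openin X K)"


section \<open>The ultrafilter semicategory\<close>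

text \<open>\<open>V * W\<close> on sets is the elementwise product of \<^theory>\<open>HOL-Library.Set_Algebras\<close>.\<close>

definition ultrafilter_semicategory ::
    "'a::{semigroup_mult, zero} set \<Rightarrow> 'a set partial_magma" where
  "ultrafilter_semicategory P =
     \<lparr>carrier = ultrafilters (restr_order P),
      composable = {(V, W) \<in> ultrafilters (restr_order P) \<times> ultrafilters (restr_order P).
                      0 \<notin> V * W},
      pprod = (\<lambda>V W. up_closure (restr_order P) (V * W))\<rparr>"

end

(* An ultrafilter is recognised locally: a filter F avoiding 0 is maximal as soon as some a in F
   has the property that each x below a lies in F or is disjoint from a member of F.  Every
   x below v w is v (w s(x)), so this criterion transfers from W to the upward closure of v W, and
   similarly from U to the upward closure of s(U).  For the range projections U^R one splits a
   projection p fixing u in U as a join of q and r and uses u = q u \<or> r u.  Hence V . W equals the upward closure of v W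
   for every single v in V, and 0 is not in V W precisely when every s(v) with v in V lies in
   W^R: the set s(v) W generates an ultrafilter above W, so it generates W itself.  Then V . W
   is defined iff the upward closures of V^S and W^R agree.

   Topologically, s maps O_a injectively onto O_{s(a)}: its inverse sends E to the upward closure
   of a E.  Composability fails exactly on the union of the boxes O_v x O_w with v w = 0, and each
   O_b is compact by the usual Stone duality argument in the Boolean algebra below b. *)

theory Submission
  imports Defs
begin

section \<open>Restriction semigroups\<close>

context restriction_semigroup
begin

section \<open>The natural order and source projections\<close>

abbreviation below :: "'a \<Rightarrow> 'a \<Rightarrow> bool" (infix "\<preceq>" 50) where
  "a \<preceq> b \<equiv> a \<sqsubseteq>\<^bsub>restr_order P\<^esub> b"

abbreviation src :: "'a \<Rightarrow> 'a" where
  "src \<equiv> source_proj P"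

lemma below_iff: "a \<preceq> b \<longleftrightarrow> (\<exists>p\<in>P. a = b * p)"
  by (simp add: restr_order_def)

lemma mult_proj_below: "p \<in> P \<Longrightarrow> a * p \<preceq> a"
  by (auto simp: below_iff)

lemma proj_below_iff: "\<lbrakk>p \<in> P; q \<in> P\<rbrakk> \<Longrightarrow> p \<preceq> q \<longleftrightarrow> q * p = p"
  by (metis below_iff mult.assoc proj_idem)

lemma is_source_proj_iff:
  "is_source_proj P a p \<longleftrightarrow> p \<in> P \<and> a * p = a \<and> (\<forall>q\<in>P. a * q = a \<longrightarrow> p \<preceq> q)"
  by (auto simp: is_source_proj_def least_def restr_order_def)

lemma is_source_proj_src: "is_source_proj P a (src a)"
proof -
  obtain p where p: "is_source_proj P a p"
    using source_proj_exists by blast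
  have "q = p" if "is_source_proj P a q" for q
    using p that proj_commute proj_below_iff unfolding is_source_proj_iff by metis
  then show ?thesis
    unfolding source_proj_def using p by (rule theI[rotated])
qed

lemma src_proj [simp]: "src a \<in> P"
  and mult_src [simp]: "a * src a = a"
  and src_least: "\<lbrakk>q \<in> P; a * q = a\<rbrakk> \<Longrightarrow> src a \<preceq> q"
  using is_source_proj_src unfolding is_source_proj_iff by blast+

lemma below_refl [simp]: "a \<preceq> a"
  unfolding below_iff by (metis mult_src src_proj)

lemma below_trans: "\<lbrakk>a \<preceq> b; b \<preceq> c\<rbrakk> \<Longrightarrow> a \<preceq> c"
  unfolding below_iff by (metis mult.assoc proj_closed)

lemma below_antisym: "\<lbrakk>a \<preceq> b; b \<preceq> a\<rbrakk> \<Longrightarrow> a = b"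
  unfolding below_iff by (metis mult.assoc proj_commute proj_idem)

lemma proj_down: "\<lbrakk>a \<preceq> p; p \<in> P\<rbrakk> \<Longrightarrow> a \<in> P"
  using proj_closed by (auto simp: below_iff)

text \<open>The source is a canonical witness for the order: any \<open>p\<close> with
  \<open>a = b * p\<close> fixes \<open>a\<close>, so \<open>src a\<close> lies below
  \<open>p\<close>, and \<open>a = b * p * src a\<close> collapses to
  \<open>b * src a\<close>.\<close>

lemma below_eq_mult_src:
  assumes "a \<preceq> b"
  shows "a = b * src a"
proof -
  obtain p where p: "p \<in> P" "a = b * p"
    using assms by (auto simp: below_iff)
  then have "a * p = a"
    by (simp add: mult.assoc proj_idem)
  then have "p * src a = src a"
    using src_least p proj_below_iff by simp
  then show ?thesis
    using p by (metis mult.assoc mult_src)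
qed

text \<open>The axiom \<open>proj_mult_le\<close> lets a projection move rightwards across an
  element, \<open>p * d = d * r\<close>; this turns \<open>b * p * d * q\<close> into
  \<open>b * d\<close> times a projection.\<close>

lemma mult_mono_below:
  assumes "a \<preceq> b" "c \<preceq> d"
  shows "a * c \<preceq> b * d"
proof -
  obtain p q where pq: "p \<in> P" "q \<in> P" "a = b * p" "c = d * q"
    using assms by (auto simp: below_iff)
  obtain r where r: "r \<in> P" "p * d = d * r"
    using proj_mult_le[OF pq(1)] by (auto simp: below_iff)
  have "a * c = b * d * (r * q)"
    using pq r by (metis mult.assoc)
  then show ?thesis
    using r pq proj_closed by (auto simp: below_iff)
qed

lemma src_of_proj: "p \<in> P \<Longrightarrow> src p = p"
  by (metis mult_src proj_below_iff proj_idem src_least src_proj proj_commute)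

text \<open>The source axiom replaces \<open>a\<close> by \<open>src a\<close>, and
  \<open>src a * p\<close> is a projection, hence its own source.\<close>

lemma src_mult_proj: "p \<in> P \<Longrightarrow> src (a * p) = src a * p"
  by (metis proj_closed source_proj_mult src_of_proj src_proj)

lemma src_mult_below: "src (a * b) \<preceq> src b"
  by (rule src_least) (simp_all add: mult.assoc)

lemma src_mono: "a \<preceq> b \<Longrightarrow> src a \<preceq> src b"
  using below_eq_mult_src src_mult_proj mult_proj_below src_proj by metis

lemma proj_above_fixes:
  assumes "p \<in> P" "q \<in> P" "p \<preceq> q" "p * a = a"
  shows "q * a = a"
  using assms by (metis mult.assoc proj_below_iff)

end

section \<open>Semi-Boolean restriction semigroups\<close>

context semi_boolean_restriction_semigroup
begin

sublocale sb: semi_boolean_algebra "restr_order P"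
  by (rule semi_boolean)

lemma carrier_restr_order [simp]: "carrier (restr_order P) = UNIV"
  by (simp add: restr_order_def)

lemma zero_below [simp]: "0 \<preceq> b"
  using proj_mult_le[OF zero_proj, of b] by (simp add: zero_mult)

lemma mult_zero [simp]: "(b::'a) * 0 = 0"
proof -
  \<comment> \<open>As \<open>0\<close> is below \<open>b\<close>, it has the form
    \<open>b * p\<close>. Moreover \<open>p * 0 = 0 * p = 0\<close>, so
    \<open>b * 0 = b * p * 0 = 0 * 0\<close>.\<close>
  obtain p where "p \<in> P" "0 = b * p"
    using zero_below[of b] by (auto simp: below_iff)
  then show ?thesis
    by (metis mult.assoc proj_commute zero_mult zero_proj)
qed

lemma below_zero: "a \<preceq> 0 \<longleftrightarrow> a = 0"
  using below_antisym[OF _ zero_below] below_refl by blast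

lemma src_eq_0_iff: "src a = 0 \<longleftrightarrow> a = 0"
  by (metis mult_src mult_zero src_of_proj zero_proj)

text \<open>By the source axiom \<open>a * b\<close> and \<open>src a * b\<close> have the same
  source, and only \<open>0\<close> has source \<open>0\<close>.\<close>

lemma mult_eq_0_iff_src: "a * b = 0 \<longleftrightarrow> src a * b = 0"
  using source_proj_mult[of a b] src_eq_0_iff by metis

section \<open>Meets, joins and complements below an element\<close>

lemma ex_meet:
  obtains m where "m \<preceq> a" "m \<preceq> b" "\<And>c. \<lbrakk>c \<preceq> a; c \<preceq> b\<rbrakk> \<Longrightarrow> c \<preceq> m"
  using sb.meet_left[of a b] sb.meet_right[of a b] sb.meet_le[of _ a b] by simp

lemma join_eqI:
  assumes "a \<preceq> j" "b \<preceq> j" "\<And>u. \<lbrakk>a \<preceq> u; b \<preceq> u\<rbrakk> \<Longrightarrow> j \<preceq> u"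
  shows "a \<squnion>\<^bsub>restr_order P\<^esub> b = j"
proof -
  have l: "least (restr_order P) j (Upper (restr_order P) {a, b})"
    using assms by (auto simp: least_def Upper_def)
  show ?thesis
    unfolding join_def sup_def using l
    by (rule someI2) (use l sb.least_unique in blast)
qed

text \<open>The usual condition that the meet be \<open>0\<close>; phrased by common lower bounds,
  it needs no choice of a meet, in the poset or in a principal ideal.\<close>

definition disjnt_below :: "'a \<Rightarrow> 'a \<Rightarrow> bool" where
  "disjnt_below a b \<longleftrightarrow> (\<forall>z. z \<preceq> a \<longrightarrow> z \<preceq> b \<longrightarrow> z = 0)"

lemma disjnt_belowD: "\<lbrakk>disjnt_below a b; z \<preceq> a; z \<preceq> b\<rbrakk> \<Longrightarrow> z = 0"
  by (simp add: disjnt_below_def)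

lemma disjnt_below_sym: "disjnt_below a b \<Longrightarrow> disjnt_below b a"
  by (simp add: disjnt_below_def)

text \<open>This moves complementation in the Boolean algebra below \<open>b\<close> to the order of
  the whole poset. The last two clauses make each of \<open>x\<close> and \<open>y\<close> the
  largest element below \<open>b\<close> disjoint from the other, which is the form that compactness
  uses.\<close>

lemma ex_complement:
  assumes x: "x \<preceq> b"
  obtains y where "y \<preceq> b" "disjnt_below x y" "x \<squnion>\<^bsub>restr_order P\<^esub> y = b"
    "\<And>z. \<lbrakk>z \<preceq> b; disjnt_below z x\<rbrakk> \<Longrightarrow> z \<preceq> y"
    "\<And>z. \<lbrakk>z \<preceq> b; disjnt_below z y\<rbrakk> \<Longrightarrow> z \<preceq> x"
proof -
  define M where "M = restr_order P\<lparr>carrier := {c \<in> carrier (restr_order P). c \<preceq> b}\<rparr>"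
  interpret M: boolean_lattice M
    unfolding M_def by (rule sb.principal_ideal_boolean) simp
  have car: "c \<in> carrier M \<longleftrightarrow> c \<preceq> b" for c
    by (simp add: M_def)
  have le: "c \<sqsubseteq>\<^bsub>M\<^esub> d \<longleftrightarrow> c \<preceq> d" for c d
    by (simp add: M_def)
  have top: "\<top>\<^bsub>M\<^esub> = b"
    using M.top_closed M.top_higher[of b] car le below_antisym by auto
  have bot: "\<bottom>\<^bsub>M\<^esub> = 0"
    using M.bottom_lower[of 0] car le below_zero by auto
  obtain y where y: "y \<preceq> b" "x \<sqinter>\<^bsub>M\<^esub> y = 0" "x \<squnion>\<^bsub>M\<^esub> y = b"
    using M.complement_exists[of x] x car top bot by auto
  \<comment> \<open>Distributivity writes \<open>z\<close> as the join of its meets with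
    \<open>s\<close> and \<open>t\<close>; the first of these is \<open>0\<close>.\<close>
  have disjnt_imp_below: "z \<preceq> t"
    if st: "s \<preceq> b" "t \<preceq> b" "s \<squnion>\<^bsub>M\<^esub> t = b" and z: "z \<preceq> b" "disjnt_below z s" for s t z
  proof -
    have "z \<sqinter>\<^bsub>M\<^esub> s = 0"
      using M.meet_left[of z s] M.meet_right[of z s] z st car le disjnt_belowD by metis
    then have "z \<sqinter>\<^bsub>M\<^esub> b = 0 \<squnion>\<^bsub>M\<^esub> (z \<sqinter>\<^bsub>M\<^esub> t)"
      using M.meet_join_distrib[of z s t] z st car by simp
    moreover have "z \<preceq> z \<sqinter>\<^bsub>M\<^esub> b"
      using M.meet_le[of z z b] z car le by simp
    moreover have "0 \<squnion>\<^bsub>M\<^esub> (z \<sqinter>\<^bsub>M\<^esub> t) \<preceq> t"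
      using M.join_le[of 0 t "z \<sqinter>\<^bsub>M\<^esub> t"] M.meet_closed[of z t] M.meet_right[of z t] z st car le
      by simp
    ultimately show "z \<preceq> t"
      using below_trans by metis
  qed
  show thesis
  proof
    show "y \<preceq> b" by fact
    show "disjnt_below x y"
      unfolding disjnt_below_def
      by (metis M.meet_le below_trans below_zero car le x y(1,2))
    show "x \<squnion>\<^bsub>restr_order P\<^esub> y = b"
    proof (rule join_eqI)
      \<comment> \<open>An upper bound \<open>u\<close> may lie outside the ideal below
        \<open>b\<close>, so leastness of the join inside the ideal is applied to the meet of
        \<open>u\<close> with \<open>b\<close>.\<close>
      fix u assume u: "x \<preceq> u" "y \<preceq> u"
      obtain m where m: "m \<preceq> u" "m \<preceq> b" "\<And>c. \<lbrakk>c \<preceq> u; c \<preceq> b\<rbrakk> \<Longrightarrow> c \<preceq> m"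
        using ex_meet by blast
      have "b \<preceq> m"
        using M.join_le[of x m y] m u x y car le by auto
      then show "b \<preceq> u"
        using m below_trans by blast
    qed (use x y in auto)
    show "z \<preceq> y" if "z \<preceq> b" "disjnt_below z x" for z
      using disjnt_imp_below[OF x y(1,3)] that .
    show "z \<preceq> x" if "z \<preceq> b" "disjnt_below z y" for z
      using disjnt_imp_below[OF y(1) x, of z] y(3) that by (simp add: join_comm[of M x y])
  qed
qed

section \<open>Ultrafilters\<close>

abbreviation up :: "'a set \<Rightarrow> 'a set" where
  "up \<equiv> up_closure (restr_order P)"

abbreviation filt :: "'a set \<Rightarrow> bool" where
  "filt \<equiv> order_filter (restr_order P)"

abbreviation UF :: "'a set set" where
  "UF \<equiv> ultrafilters (restr_order P)"

lemma mem_up: "c \<in> up T \<longleftrightarrow> (\<exists>t\<in>T. t \<preceq> c)"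
  by (simp add: up_closure_def)

lemma up_incl: "t \<in> T \<Longrightarrow> t \<in> up T"
  using mem_up below_refl by blast

lemma filt_iff:
  "filt F \<longleftrightarrow> F \<noteq> {} \<and> (\<forall>a\<in>F. \<forall>b. a \<preceq> b \<longrightarrow> b \<in> F) \<and>
     (\<forall>a\<in>F. \<forall>b\<in>F. \<exists>c\<in>F. c \<preceq> a \<and> c \<preceq> b)"
  by (auto simp: order_filter_def)

lemma filt_upI:
  assumes "T \<noteq> {}" "\<And>a b. \<lbrakk>a \<in> T; b \<in> T\<rbrakk> \<Longrightarrow> \<exists>c\<in>T. c \<preceq> a \<and> c \<preceq> b"
  shows "filt (up T)"
  unfolding filt_iff
proof (intro conjI ballI allI impI)
  show "up T \<noteq> {}"
    using assms(1) up_incl by blast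
  show "b \<in> up T" if "a \<in> up T" "a \<preceq> b" for a b
    using that below_trans unfolding mem_up by blast
  show "\<exists>c\<in>up T. c \<preceq> a \<and> c \<preceq> b" if ab: "a \<in> up T" "b \<in> up T" for a b
  proof -
    obtain s t where "s \<in> T" "s \<preceq> a" "t \<in> T" "t \<preceq> b"
      using ab unfolding mem_up by blast
    moreover obtain c where "c \<in> T" "c \<preceq> s" "c \<preceq> t"
      using assms(2) calculation by blast
    ultimately show ?thesis
      using below_trans[of c s a] below_trans[of c t b] up_incl by blast
  qed
qed

lemma zero_notin_up: "0 \<notin> up T \<longleftrightarrow> 0 \<notin> T"
  by (simp add: mem_up below_zero)

lemma proper_filt_iff: "proper_order_filter (restr_order P) F \<longleftrightarrow> filt F \<and> 0 \<notin> F"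
  unfolding proper_order_filter_def using zero_below by (auto simp: filt_iff)

lemma UF_filt: "U \<in> UF \<Longrightarrow> filt U"
  and UF_zero: "U \<in> UF \<Longrightarrow> 0 \<notin> U"
  and UF_max: "\<lbrakk>U \<in> UF; filt F; 0 \<notin> F; U \<subseteq> F\<rbrakk> \<Longrightarrow> F = U"
  by (auto simp: ultrafilters_def proper_filt_iff)

lemma UF_nonempty: "U \<in> UF \<Longrightarrow> U \<noteq> {}"
  using UF_filt by (auto simp: filt_iff)

lemma UF_up: "\<lbrakk>U \<in> UF; a \<in> U; a \<preceq> b\<rbrakk> \<Longrightarrow> b \<in> U"
  using UF_filt unfolding filt_iff by blast

lemma UF_lower:
  assumes "U \<in> UF" "a \<in> U" "b \<in> U"
  obtains c where "c \<in> U" "c \<preceq> a" "c \<preceq> b"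
  using assms UF_filt unfolding filt_iff by blast

lemma UF_subset_eq: "\<lbrakk>U \<in> UF; V \<in> UF; U \<subseteq> V\<rbrakk> \<Longrightarrow> U = V"
  using UF_max UF_filt UF_zero by blast

section \<open>Disjointness, maximality and extension of filters\<close>

lemma UF_not_disjnt: "\<lbrakk>U \<in> UF; a \<in> U; b \<in> U\<rbrakk> \<Longrightarrow> \<not> disjnt_below a b"
  using UF_lower UF_zero disjnt_belowD by metis

text \<open>If \<open>x\<close> met every member of \<open>U\<close> in a nonzero element, these
  meets would generate a proper filter containing both \<open>U\<close> and \<open>x\<close>,
  against maximality. So some member has zero meet with \<open>x\<close>, and a member below it and
  \<open>a\<close> serves as \<open>y\<close>.\<close>

lemma UF_disjnt:
  assumes U: "U \<in> UF" and x: "x \<notin> U" and a: "a \<in> U"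
  obtains y where "y \<in> U" "y \<preceq> a" "disjnt_below y x"
proof -
  \<comment> \<open>These are the elements between the meet of some \<open>u\<close> in
    \<open>U\<close> with \<open>x\<close> and \<open>x\<close> itself, described through lower
    bounds only.\<close>
  let ?T = "{m. m \<preceq> x \<and> (\<exists>u\<in>U. \<forall>z. z \<preceq> u \<longrightarrow> z \<preceq> x \<longrightarrow> z \<preceq> m)}"
  have filt: "filt (up ?T)"
  proof (rule filt_upI)
    show "?T \<noteq> {}"
      using a below_refl by blast
    fix m n assume "m \<in> ?T" "n \<in> ?T"
    then obtain u v where uv: "u \<in> U" "v \<in> U" "m \<preceq> x" "n \<preceq> x"
      "\<And>z. \<lbrakk>z \<preceq> u; z \<preceq> x\<rbrakk> \<Longrightarrow> z \<preceq> m" "\<And>z. \<lbrakk>z \<preceq> v; z \<preceq> x\<rbrakk> \<Longrightarrow> z \<preceq> n"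
      by blast
    obtain w where w: "w \<in> U" "w \<preceq> u" "w \<preceq> v"
      using UF_lower U uv by metis
    obtain k where k: "k \<preceq> m" "k \<preceq> n" "\<And>c. \<lbrakk>c \<preceq> m; c \<preceq> n\<rbrakk> \<Longrightarrow> c \<preceq> k"
      using ex_meet by blast
    have "z \<preceq> k" if "z \<preceq> w" "z \<preceq> x" for z
      using k(3)[OF uv(5)[OF below_trans[OF that(1) w(2)] that(2)]
          uv(6)[OF below_trans[OF that(1) w(3)] that(2)]] .
    then have "k \<in> ?T"
      using below_trans[OF k(1) uv(3)] w(1) by blast
    then show "\<exists>c\<in>?T. c \<preceq> m \<and> c \<preceq> n"
      using k by blast
  qed
  have sub: "U \<subseteq> up ?T"
  proof
    fix u assume u: "u \<in> U"
    obtain m where "m \<preceq> u" "m \<preceq> x" "\<And>z. \<lbrakk>z \<preceq> u; z \<preceq> x\<rbrakk> \<Longrightarrow> z \<preceq> m"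
      using ex_meet by blast
    then show "u \<in> up ?T"
      unfolding mem_up using u by blast
  qed
  have mem: "x \<in> up ?T"
    unfolding mem_up using a by (intro bexI[of _ x]) auto
  have "0 \<in> up ?T"
  proof (rule ccontr)
    assume "0 \<notin> up ?T"
    from UF_max[OF U filt this sub] mem x show False
      by (simp only:)
  qed
  then obtain m where "m \<in> ?T" "m = 0"
    unfolding mem_up below_zero by blast
  then obtain u where u: "u \<in> U" "\<And>z. \<lbrakk>z \<preceq> u; z \<preceq> x\<rbrakk> \<Longrightarrow> z = 0"
    by (auto simp: below_zero)
  obtain y where y: "y \<in> U" "y \<preceq> a" "y \<preceq> u"
    using UF_lower[OF U a u(1)] .
  have "disjnt_below y x"
    unfolding disjnt_below_def using u(2) below_trans[OF _ y(3)] by blast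
  then show thesis
    using that y by blast
qed

text \<open>Let \<open>G\<close> be a proper filter containing \<open>F\<close>. Any
  \<open>g\<close> in \<open>G\<close> has some \<open>h\<close> in \<open>G\<close> below both
  \<open>g\<close> and \<open>a\<close>. Were \<open>h\<close> outside \<open>F\<close>, then
  \<open>G\<close> would contain it together with a disjoint element, hence \<open>0\<close>. So
  \<open>h\<close>, and with it \<open>g\<close>, lies in \<open>F\<close>.\<close>

lemma UF_criterion:
  assumes F: "filt F" "0 \<notin> F" "a \<in> F"
    and split: "\<And>x. \<lbrakk>x \<preceq> a; x \<notin> F\<rbrakk> \<Longrightarrow> \<exists>y\<in>F. disjnt_below y x"
  shows "F \<in> UF"
proof -
  have "G = F" if G: "filt G" "0 \<notin> G" "F \<subseteq> G" for G
  proof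
    show "G \<subseteq> F"
    proof
      fix g assume "g \<in> G"
      then obtain h where h: "h \<in> G" "h \<preceq> a" "h \<preceq> g"
        using G F unfolding filt_iff by blast
      have "h \<in> F"
      proof (rule ccontr)
        assume "h \<notin> F"
        then obtain y where y: "y \<in> F" "disjnt_below y h"
          using split h by blast
        then obtain z where "z \<in> G" "z \<preceq> y" "z \<preceq> h"
          using G h unfolding filt_iff by blast
        then show False
          using y G disjnt_belowD by blast
      qed
      then show "g \<in> F"
        using h F unfolding filt_iff by blast
    qed
  qed fact
  then show ?thesis
    using F by (auto simp: ultrafilters_def proper_filt_iff)
qed

text \<open>\<open>UF_disjnt\<close> finds in \<open>U\<close> an element below \<open>b\<close>
  disjoint from \<open>x\<close>, and \<open>y\<close> dominates it. The hypothesis on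
  \<open>y\<close> is met by the complement of \<open>x\<close> in \<open>b\<close>, and also by
  \<open>r * w\<close> in \<open>UF_range\<close>.\<close>

lemma UF_prime:
  assumes "U \<in> UF" "b \<in> U" "x \<notin> U" "\<And>z. \<lbrakk>z \<preceq> b; disjnt_below z x\<rbrakk> \<Longrightarrow> z \<preceq> y"
  shows "y \<in> U"
  using UF_disjnt[OF assms(1,3,2)] assms UF_up by metis

text \<open>Zorn's lemma applies because two members of the union of a chain lie in a single filter
  of the chain. Compactness needs this abstract extension; the ultrafilters of the algebraic part
  are explicit and come from \<open>UF_criterion\<close>.\<close>

lemma UF_extend:
  assumes F: "filt F" "0 \<notin> F"
  obtains U where "U \<in> UF" "F \<subseteq> U"
proof -
  let ?A = "{G. filt G \<and> 0 \<notin> G \<and> F \<subseteq> G}"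
  have "\<exists>M\<in>?A. \<forall>X\<in>?A. M \<subseteq> X \<longrightarrow> X = M"
  proof (rule subset_Zorn_nonempty)
    show "?A \<noteq> {}"
      using F by blast
    fix C assume C: "C \<noteq> {}" "subset.chain ?A C"
    have CA: "filt G" "0 \<notin> G" "F \<subseteq> G" if "G \<in> C" for G
      using C(2) that unfolding subset_chain_def by blast+
    have lin: "G \<subseteq> H \<or> H \<subseteq> G" if "G \<in> C" "H \<in> C" for G H
      using C(2) that unfolding subset_chain_def by blast
    have "filt (\<Union>C)"
      unfolding filt_iff
    proof (intro conjI ballI allI impI)
      show "\<Union>C \<noteq> {}"
        using C(1) CA unfolding filt_iff by blast
      show "b \<in> \<Union>C" if "a \<in> \<Union>C" "a \<preceq> b" for a b
        using that CA(1) unfolding filt_iff by blast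
      show "\<exists>c\<in>\<Union>C. c \<preceq> a \<and> c \<preceq> b" if ab: "a \<in> \<Union>C" "b \<in> \<Union>C" for a b
      proof -
        obtain G where "G \<in> C" "a \<in> G" "b \<in> G"
          using ab lin by blast
        then show ?thesis
          using CA(1) unfolding filt_iff by blast
      qed
    qed
    then show "\<Union>C \<in> ?A"
      using C(1) CA by blast
  qed
  then obtain M where M: "M \<in> ?A" "\<forall>X\<in>?A. M \<subseteq> X \<longrightarrow> X = M"
    by (rule bexE)
  have "X = M" if "filt X" "0 \<notin> X" "M \<subseteq> X" for X
    using M that by auto
  then have "M \<in> UF"
    using M(1) by (simp add: ultrafilters_def proper_filt_iff)
  then show thesis
    using M(1) that by simp
qed

section \<open>Products of ultrafilters\<close>

lemma UF_translate:
  assumes W: "W \<in> UF" and nz: "\<And>w. w \<in> W \<Longrightarrow> v * w \<noteq> 0"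
  shows "up ((*) v ` W) \<in> UF"
proof -
  obtain w where w: "w \<in> W"
    using UF_nonempty W by blast
  show ?thesis
  proof (rule UF_criterion[where a = "v * w"])
    show "filt (up ((*) v ` W))"
    proof (rule filt_upI)
      fix a b assume "a \<in> (*) v ` W" "b \<in> (*) v ` W"
      then obtain x y where "x \<in> W" "y \<in> W" "a = v * x" "b = v * y"
        by blast
      moreover obtain z where "z \<in> W" "z \<preceq> x" "z \<preceq> y"
        using UF_lower[OF W] calculation by metis
      ultimately show "\<exists>c\<in>(*) v ` W. c \<preceq> a \<and> c \<preceq> b"
        using mult_mono_below[OF below_refl[of v]] by blast
    qed (use w in auto)
    show "0 \<notin> up ((*) v ` W)"
      using nz unfolding zero_notin_up by force
    show "v * w \<in> up ((*) v ` W)"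
      using w by (intro up_incl imageI)
    fix x assume x: "x \<preceq> v * w" "x \<notin> up ((*) v ` W)"
    \<comment> \<open>The ideal below \<open>v * w\<close> is thus reached from the ideal below
      \<open>w\<close>: \<open>x\<close> is the translate of \<open>w * src x\<close>, to which the
      ultrafilter \<open>W\<close> can be applied.\<close>
    have x': "x = v * (w * src x)"
      using below_eq_mult_src[OF x(1)] by (simp add: mult.assoc)
    then have "w * src x \<notin> W"
      using x(2) up_incl[of "v * (w * src x)" "(*) v ` W"] by auto
    then obtain y where y: "y \<in> W" "y \<preceq> w" "disjnt_below y (w * src x)"
      using UF_disjnt[OF W _ w] by metis
    \<comment> \<open>A common lower bound \<open>z\<close> is itself the translate of
      \<open>w * src z\<close>, which lies below both \<open>y\<close> and \<open>w * src x\<close>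
      and is therefore \<open>0\<close>.\<close>
    have "disjnt_below (v * y) x"
      unfolding disjnt_below_def
    proof (intro allI impI)
      fix z assume z: "z \<preceq> v * y" "z \<preceq> x"
      have "src z \<preceq> src y"
        using below_trans[OF src_mono[OF z(1)] src_mult_below] .
      then have "w * src z \<preceq> y"
        using mult_mono_below[OF below_refl[of w]] below_eq_mult_src[OF y(2)] by metis
      moreover have "w * src z \<preceq> w * src x"
        using mult_mono_below[OF below_refl src_mono[OF z(2)]] .
      ultimately have "w * src z = 0"
        using y(3) disjnt_belowD by blast
      moreover have "z = v * (w * src z)"
        using below_eq_mult_src[OF below_trans[OF z(2) x(1)]] by (simp add: mult.assoc)
      ultimately show "z = 0"
        by simp
    qed
    then show "\<exists>y\<in>up ((*) v ` W). disjnt_below y x"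
      using up_incl[OF imageI[OF y(1)]] by blast
  qed
qed

section \<open>Nonvanishing products and range projections\<close>

lemma zero_notin_times: "0 \<notin> V * W \<longleftrightarrow> (\<forall>v\<in>V. \<forall>w\<in>W. v * w \<noteq> 0)"
  by (force simp: set_times_def)

lemma filt_up_times:
  assumes "V \<in> UF" "W \<in> UF"
  shows "filt (up (V * W))"
proof (rule filt_upI)
  show "V * W \<noteq> {}"
    using assms UF_nonempty unfolding set_times_def by blast
  fix a b assume "a \<in> V * W" "b \<in> V * W"
  then obtain v w v' w' where "v \<in> V" "w \<in> W" "v' \<in> V" "w' \<in> W" "a = v * w" "b = v' * w'"
    by (auto elim!: set_times_elim)
  moreover obtain x where "x \<in> V" "x \<preceq> v" "x \<preceq> v'"
    using UF_lower[OF assms(1)] calculation by metis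
  moreover obtain y where "y \<in> W" "y \<preceq> w" "y \<preceq> w'"
    using UF_lower[OF assms(2)] calculation by metis
  ultimately show "\<exists>c\<in>V * W. c \<preceq> a \<and> c \<preceq> b"
    using mult_mono_below set_times_intro by metis
qed

text \<open>The translate by a single \<open>v\<close> is already maximal, and the filter generated
  by all products is a proper filter above it.\<close>

lemma up_times_eq_translate:
  assumes "V \<in> UF" "W \<in> UF" "0 \<notin> V * W" "v \<in> V"
  shows "up (V * W) = up ((*) v ` W)"
proof (rule UF_max)
  show "up ((*) v ` W) \<in> UF"
    using assms by (intro UF_translate) (auto simp: zero_notin_times)
  show "filt (up (V * W))"
    using assms filt_up_times by blast
  show "0 \<notin> up (V * W)"
    using assms zero_notin_up by blast
  show "up ((*) v ` W) \<subseteq> up (V * W)"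
    using assms(4) unfolding mem_up subset_iff set_times_def by blast
qed

lemma UF_times:
  assumes "V \<in> UF" "W \<in> UF" "0 \<notin> V * W"
  shows "up (V * W) \<in> UF"
proof -
  obtain v where "v \<in> V"
    using UF_nonempty assms(1) by blast
  then show ?thesis
    using up_times_eq_translate[OF assms] UF_translate[OF assms(2)] assms(3)
    by (simp add: zero_notin_times)
qed

text \<open>One fixed element \<open>a\<close> suffices: a common lower bound \<open>b\<close> in
  \<open>W\<close> of \<open>a\<close> and \<open>w\<close> is again fixed by \<open>p\<close>, so
  \<open>b = p * b\<close> lies below \<open>p * w\<close>. In the other direction
  \<open>p * w\<close> is itself fixed by \<open>p\<close>.\<close>

lemma range_set_iff:
  assumes "W \<in> UF"
  shows "p \<in> range_set P W \<longleftrightarrow> p \<in> P \<and> (\<forall>w\<in>W. p * w \<in> W)"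
proof
  assume "p \<in> range_set P W"
  then obtain a where a: "p \<in> P" "a \<in> W" "p * a = a"
    by (auto simp: range_set_def)
  have "p * w \<in> W" if w: "w \<in> W" for w
  proof -
    obtain b where b: "b \<in> W" "b \<preceq> a" "b \<preceq> w"
      using UF_lower assms a w by metis
    then have "p * b = b"
      using a below_eq_mult_src[OF b(2)] by (metis mult.assoc)
    then have "b \<preceq> p * w"
      using mult_mono_below[OF below_refl[of p] b(3)] by simp
    then show ?thesis
      using UF_up assms b by blast
  qed
  then show "p \<in> P \<and> (\<forall>w\<in>W. p * w \<in> W)"
    using a by blast
next
  assume p: "p \<in> P \<and> (\<forall>w\<in>W. p * w \<in> W)"
  obtain w where "w \<in> W"
    using UF_nonempty assms by blast
  then have "p * w \<in> W" "p * (p * w) = p * w"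
    using p by (simp_all add: mult.assoc[symmetric] proj_idem)
  then show "p \<in> range_set P W"
    using p unfolding range_set_def by blast
qed

lemma composable_iff:
  assumes V: "V \<in> UF" and W: "W \<in> UF"
  shows "0 \<notin> V * W \<longleftrightarrow> (\<forall>v\<in>V. src v \<in> range_set P W)"
proof
  assume nz: "0 \<notin> V * W"
  show "\<forall>v\<in>V. src v \<in> range_set P W"
  proof
    fix v assume v: "v \<in> V"
    let ?F = "up ((*) (src v) ` W)"
    have "?F \<in> UF"
      using nz v by (intro UF_translate[OF W]) (simp add: zero_notin_times mult_eq_0_iff_src[symmetric])
    \<comment> \<open>Multiplying by the projection \<open>src v\<close> on the left only moves down
      in the order, so \<open>?F\<close> contains \<open>W\<close>; ultrafilters related by
      inclusion are equal.\<close>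
    moreover have "W \<subseteq> ?F"
      using proj_mult_le[OF src_proj] unfolding mem_up subset_iff by blast
    ultimately have "W = ?F"
      using UF_subset_eq W by blast
    then show "src v \<in> range_set P W"
      using up_incl unfolding range_set_iff[OF W] by (metis imageI src_proj)
  qed
next
  assume R: "\<forall>v\<in>V. src v \<in> range_set P W"
  have "v * w \<noteq> 0" if "v \<in> V" "w \<in> W" for v w
    using R that UF_zero[OF W] unfolding range_set_iff[OF W] mult_eq_0_iff_src[of v w] by metis
  then show "0 \<notin> V * W"
    by (simp add: zero_notin_times)
qed

section \<open>Source and range ultrafilters\<close>

lemma up_source_set: "up (source_set P U) = up (src ` U)"
proof -
  \<comment> \<open>Any projection fixing \<open>a\<close> lies above \<open>src a\<close>, so the
    least ones generate the same up-set. From here on \<open>src\<close> applied to \<open>U\<close>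
    replaces \<open>source_set P U\<close>.\<close>
  have "\<exists>t\<in>src ` U. t \<preceq> c" if "p \<in> P" "a \<in> U" "a * p = a" "p \<preceq> c" for p a c
    using that below_trans[OF src_least[OF that(1,3)] that(4)] by blast
  moreover have "\<exists>t\<in>source_set P U. t \<preceq> c" if "a \<in> U" "src a \<preceq> c" for a c
    using that src_proj mult_src unfolding source_set_def by blast
  ultimately show ?thesis
    unfolding set_eq_iff mem_up by (auto simp: source_set_def)
qed

lemma UF_source:
  assumes U: "U \<in> UF"
  shows "up (src ` U) \<in> UF"
proof -
  obtain a where a: "a \<in> U"
    using UF_nonempty U by blast
  show ?thesis
  proof (rule UF_criterion[where a = "src a"])
    show "filt (up (src ` U))"
    proof (rule filt_upI)
      fix p q assume "p \<in> src ` U" "q \<in> src ` U"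
      then obtain b c where bc: "b \<in> U" "c \<in> U" "p = src b" "q = src c"
        by blast
      obtain d where "d \<in> U" "d \<preceq> b" "d \<preceq> c"
        using UF_lower[OF U bc(1,2)] .
      then show "\<exists>c\<in>src ` U. c \<preceq> p \<and> c \<preceq> q"
        using src_mono bc(3,4) by blast
    qed (use a in auto)
    show "0 \<notin> up (src ` U)"
      using UF_zero[OF U] src_eq_0_iff unfolding zero_notin_up by force
    show "src a \<in> up (src ` U)"
      using a by (intro up_incl imageI)
    fix x assume x: "x \<preceq> src a" "x \<notin> up (src ` U)"
    have xP: "x \<in> P"
      using x(1) proj_down src_proj by blast
    \<comment> \<open>This matches projections below \<open>src a\<close> with elements below
      \<open>a\<close>: \<open>x\<close> goes to \<open>a * x\<close>, and the source recovers it.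
      The question is thereby moved into \<open>U\<close>.\<close>
    have "src (a * x) = x"
      using src_mult_proj[OF xP] proj_below_iff[OF xP src_proj] x(1) by simp
    then have "a * x \<notin> U"
      using x(2) up_incl by (metis imageI)
    then obtain y where y: "y \<in> U" "y \<preceq> a" "disjnt_below y (a * x)"
      using UF_disjnt[OF U _ a] by metis
    have "disjnt_below (src y) x"
      unfolding disjnt_below_def
    proof (intro allI impI)
      fix z assume z: "z \<preceq> src y" "z \<preceq> x"
      have "a * z \<preceq> y"
        using mult_mono_below[OF below_refl[of a] z(1)] below_eq_mult_src[OF y(2)] by simp
      moreover have "a * z \<preceq> a * x"
        using mult_mono_below[OF below_refl z(2)] .
      ultimately have "a * z = 0"
        using y(3) disjnt_belowD by blast
      then have "src a * z = 0"
        using mult_eq_0_iff_src by blast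
      moreover have "src a * z = z"
        using proj_below_iff[OF _ src_proj] below_trans[OF z(2) x(1)] proj_down[OF z(2) xP] by blast
      ultimately show "z = 0"
        by simp
    qed
    then show "\<exists>y\<in>up (src ` U). disjnt_below y x"
      using up_incl[OF imageI[OF y(1)]] by blast
  qed
qed

text \<open>Below the projection \<open>p\<close> everything is a projection, so a \<open>q\<close>
  outside the filter has a complement \<open>r\<close> in \<open>p\<close> that is a projection too.
  Since \<open>p\<close> fixes \<open>w\<close>, the ultrafilter \<open>W\<close> must contain
  \<open>q * w\<close> or \<open>r * w\<close>, which puts \<open>q\<close> or \<open>r\<close> into
  \<open>range_set P W\<close>.\<close>

lemma UF_range:
  assumes W: "W \<in> UF" and ne: "range_set P W \<noteq> {}"
  shows "up (range_set P W) \<in> UF"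
proof -
  obtain p where p: "p \<in> range_set P W"
    using ne by blast
  then obtain w where w: "p \<in> P" "w \<in> W" "p * w = w"
    by (auto simp: range_set_def)
  show ?thesis
  proof (rule UF_criterion[where a = p])
    show "filt (up (range_set P W))"
    proof (rule filt_upI[OF ne])
      fix q r assume qr: "q \<in> range_set P W" "r \<in> range_set P W"
      then have "q * r \<in> range_set P W" "q \<in> P" "r \<in> P"
        unfolding range_set_iff[OF W] by (auto simp: mult.assoc proj_closed)
      then show "\<exists>c\<in>range_set P W. c \<preceq> q \<and> c \<preceq> r"
        using mult_proj_below proj_mult_le by blast
    qed
    show "0 \<notin> up (range_set P W)"
      using UF_zero[OF W] w unfolding zero_notin_up range_set_iff[OF W] zero_mult by blast
    show "p \<in> up (range_set P W)"
      using p up_incl by blast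
    fix q assume q: "q \<preceq> p" "q \<notin> up (range_set P W)"
    have qP: "q \<in> P"
      using q(1) w(1) proj_down by blast
    obtain r where r: "r \<preceq> p" "disjnt_below q r" "q \<squnion>\<^bsub>restr_order P\<^esub> r = p"
      using ex_complement[OF q(1)] by metis
    have rP: "r \<in> P"
      using r(1) w(1) proj_down by blast
    have qw: "q * w \<notin> W"
    proof
      assume "q * w \<in> W"
      moreover have "q * (q * w) = q * w"
        by (simp add: mult.assoc[symmetric] proj_idem qP)
      ultimately have "q \<in> range_set P W"
        using qP unfolding range_set_def by blast
      then show False
        using q(2) up_incl by blast
    qed
    \<comment> \<open>A \<open>z\<close> below \<open>w\<close> is fixed by \<open>p\<close>, so
      \<open>join_mult\<close> splits it as the join of \<open>q * z\<close> and
      \<open>r * z\<close>. If \<open>z\<close> is disjoint from \<open>q * w\<close>, the first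
      part is \<open>0\<close>, being below both, and \<open>z = r * z\<close> lies below
      \<open>r * w\<close>.\<close>
    have "r * w \<in> W"
    proof (rule UF_prime[OF W w(2) qw])
      fix z assume z: "z \<preceq> w" "disjnt_below z (q * w)"
      have "q * z \<preceq> q * w"
        using mult_mono_below[OF below_refl z(1)] .
      then have qz: "q * z = 0"
        using z(2) proj_mult_le[OF qP] disjnt_belowD by blast
      have "p * z = z"
        using w(3) below_eq_mult_src[OF z(1)] by (metis mult.assoc)
      then have "z = (q \<squnion>\<^bsub>restr_order P\<^esub> r) * z"
        using r(3) by simp
      also have "\<dots> = 0 \<squnion>\<^bsub>restr_order P\<^esub> (r * z)"
        using join_mult[of q r z] q(1) r(1) qz by auto
      also have "\<dots> = r * z"
        by (rule join_eqI) auto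
      finally show "z \<preceq> r * w"
        using mult_mono_below[OF below_refl[of r] z(1)] by simp
    qed
    moreover have "r * (r * w) = r * w"
      by (simp add: mult.assoc[symmetric] proj_idem rP)
    ultimately have "r \<in> range_set P W"
      using rP unfolding range_set_def by blast
    then show "\<exists>y\<in>up (range_set P W). disjnt_below y q"
      using up_incl disjnt_below_sym[OF r(2)] by blast
  qed
qed

section \<open>The semicategory of ultrafilters\<close>

abbreviation S :: "'a set partial_magma" where
  "S \<equiv> ultrafilter_semicategory P"

section \<open>The partial product and its associativity\<close>

lemma carrier_S [simp]: "carrier S = UF"
  and composable_S: "(V, W) \<in> composable S \<longleftrightarrow> V \<in> UF \<and> W \<in> UF \<and> 0 \<notin> V * W"
  and pprod_S: "V \<cdot>\<^bsub>S\<^esub> W = up (V * W)"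
  by (auto simp: ultrafilter_semicategory_def)

text \<open>Monotonicity of multiplication makes closing up an inner factor harmless. Together with
  its mirror image this turns iterated partial products into upward closures of elementwise
  products.\<close>

lemma up_up_times: "up (up T * C) = up (T * C)"
proof -
  have "\<exists>t\<in>T * C. t \<preceq> x" if x: "u \<in> up T" "c \<in> C" "u * c \<preceq> x" for u c x
  proof -
    obtain t where "t \<in> T" "t \<preceq> u"
      using x(1) unfolding mem_up by blast
    then show ?thesis
      using x mult_mono_below[OF _ below_refl[of c]] below_trans set_times_intro by metis
  qed
  then have "up (up T * C) \<subseteq> up (T * C)"
    unfolding subset_iff mem_up[of _ "T * C"] mem_up[of _ "up T * C"]
    by (auto elim!: set_times_elim)
  moreover have "T * C \<subseteq> up T * C"
    using up_incl by (intro set_times_mono2) auto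
  ultimately show ?thesis
    unfolding up_closure_def by blast
qed

lemma up_times_up: "up (A * up T) = up (A * T)"
proof -
  have "\<exists>t\<in>A * T. t \<preceq> x" if x: "u \<in> up T" "a \<in> A" "a * u \<preceq> x" for u a x
  proof -
    obtain t where "t \<in> T" "t \<preceq> u"
      using x(1) unfolding mem_up by blast
    then show ?thesis
      using x mult_mono_below[OF below_refl[of a]] below_trans set_times_intro by metis
  qed
  then have "up (A * up T) \<subseteq> up (A * T)"
    unfolding subset_iff mem_up[of _ "A * T"] mem_up[of _ "A * up T"]
    by (auto elim!: set_times_elim)
  moreover have "A * T \<subseteq> A * up T"
    using up_incl by (intro set_times_mono2) auto
  ultimately show ?thesis
    unfolding up_closure_def by blast
qed

lemma zero_in_times_left:
  assumes "(0::'a) \<in> T" "C \<noteq> {}"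
  shows "0 \<in> T * C"
proof -
  obtain c where "c \<in> C"
    using assms(2) by blast
  then have "0 * c \<in> T * C"
    by (rule set_times_intro[OF assms(1)])
  then show ?thesis
    by (simp add: zero_mult)
qed

lemma zero_in_times_right:
  assumes "(0::'a) \<in> T" "C \<noteq> {}"
  shows "0 \<in> C * T"
proof -
  obtain c where "c \<in> C"
    using assms(2) by blast
  then have "c * 0 \<in> C * T"
    using assms(1) by (rule set_times_intro)
  then show ?thesis
    by simp
qed

lemma semigroupoid_S: "semigroupoid S"
proof
  show "composable S \<subseteq> carrier S \<times> carrier S"
    using composable_S by auto
  show "a \<cdot>\<^bsub>S\<^esub> b \<in> carrier S" if "(a, b) \<in> composable S" for a b
    using that UF_times by (simp add: composable_S pprod_S)
  show "((a, b) \<in> composable S \<and> (a \<cdot>\<^bsub>S\<^esub> b, c) \<in> composable S) \<longleftrightarrow>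
        ((b, c) \<in> composable S \<and> (a, b \<cdot>\<^bsub>S\<^esub> c) \<in> composable S)"
    if abc: "a \<in> carrier S" "b \<in> carrier S" "c \<in> carrier S" for a b c
  proof -
    have ne: "a \<noteq> {}" "c \<noteq> {}"
      using abc UF_nonempty by auto
    \<comment> \<open>If \<open>0\<close> were in \<open>a * b\<close>, it would be in
      \<open>a * b * c\<close> as well, since \<open>c\<close> is nonempty. So each bracketing is
      defined exactly when the elementwise triple product avoids \<open>0\<close>.\<close>
    have "(a, b) \<in> composable S \<and> (a \<cdot>\<^bsub>S\<^esub> b, c) \<in> composable S \<longleftrightarrow> 0 \<notin> a * b * c"
      using abc UF_times zero_in_times_left[OF _ ne(2), of "a * b"]
        zero_notin_up[of "up (a * b) * c"] zero_notin_up[of "a * b * c"]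
      by (auto simp: composable_S pprod_S up_up_times)
    moreover have "(b, c) \<in> composable S \<and> (a, b \<cdot>\<^bsub>S\<^esub> c) \<in> composable S \<longleftrightarrow> 0 \<notin> a * (b * c)"
      using abc UF_times zero_in_times_right[OF _ ne(1), of "b * c"]
        zero_notin_up[of "a * up (b * c)"] zero_notin_up[of "a * (b * c)"]
      by (auto simp: composable_S pprod_S up_times_up)
    ultimately show ?thesis
      by (simp add: mult.assoc)
  qed
  show "(a \<cdot>\<^bsub>S\<^esub> b) \<cdot>\<^bsub>S\<^esub> c = a \<cdot>\<^bsub>S\<^esub> (b \<cdot>\<^bsub>S\<^esub> c)" for a b c
    by (simp add: pprod_S up_up_times up_times_up mult.assoc)
qed

sublocale semigroupoid S
  by (rule semigroupoid_S)

section \<open>Units, and composability in terms of units\<close>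

lemma unit_setI:
  assumes E: "E \<in> UF" and p: "p \<in> E" "p \<in> P"
  shows "E \<in> unit_set S"
proof -
  have "E \<cdot>\<^bsub>S\<^esub> A = A" if c: "(E, A) \<in> composable S" for A
  proof -
    \<comment> \<open>For \<open>x\<close> in \<open>A\<close> the product \<open>p * x\<close> is
      below \<open>x\<close>, so the composite contains \<open>A\<close>; both are ultrafilters,
      hence equal. Right multiplication by \<open>p\<close> behaves alike.\<close>
    have "A \<subseteq> E \<cdot>\<^bsub>S\<^esub> A"
      using p proj_mult_le set_times_intro unfolding subset_iff pprod_S mem_up by blast
    then show ?thesis
      using c UF_times UF_subset_eq unfolding composable_S pprod_S by metis
  qed
  moreover have "A \<cdot>\<^bsub>S\<^esub> E = A" if c: "(A, E) \<in> composable S" for A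
  proof -
    have "A \<subseteq> A \<cdot>\<^bsub>S\<^esub> E"
      using p mult_proj_below set_times_intro unfolding subset_iff pprod_S mem_up by blast
    then show ?thesis
      using c UF_times UF_subset_eq unfolding composable_S pprod_S by metis
  qed
  ultimately show ?thesis
    using E by (simp add: unit_set_def)
qed

lemma source_is_unit:
  assumes A: "A \<in> UF"
  shows "up (src ` A) \<in> unit_set S" "(A, up (src ` A)) \<in> composable S"
proof -
  obtain a where "a \<in> A"
    using UF_nonempty A by blast
  then show "up (src ` A) \<in> unit_set S"
    using unit_setI[OF UF_source[OF A], of "src a"] up_incl by simp
  have "a * e \<noteq> 0" if a: "a \<in> A" and e: "e \<in> up (src ` A)" for a e
  proof -
    obtain b where b: "b \<in> A" "src b \<preceq> e"
      using e unfolding mem_up by blast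
    \<comment> \<open>Such a \<open>c\<close> equals \<open>c * src c\<close> and bounds
      \<open>a * e\<close> from below, so \<open>a * e\<close> cannot be \<open>0\<close>.\<close>
    obtain c where c: "c \<in> A" "c \<preceq> a" "c \<preceq> b"
      using UF_lower A a b by metis
    have "c * src c \<preceq> a * e"
      using mult_mono_below[OF c(2) below_trans[OF src_mono[OF c(3)] b(2)]] .
    then show ?thesis
      using c UF_zero[OF A] below_zero by auto
  qed
  then show "(A, up (src ` A)) \<in> composable S"
    using A UF_source by (simp add: composable_S zero_notin_times)
qed

lemma source_unit_eq:
  assumes "A \<in> UF"
  shows "source_unit S A = up (src ` A)"
  unfolding source_unit_def
proof (rule the_equality)
  fix u assume "u \<in> unit_set S \<and> (A, u) \<in> composable S"
  then show "u = up (src ` A)"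
    using source_unit_unique source_is_unit[OF assms] by metis
qed (simp add: source_is_unit[OF assms])

lemma range_is_unit:
  assumes W: "W \<in> UF" and ne: "range_set P W \<noteq> {}"
  shows "up (range_set P W) \<in> unit_set S" "(up (range_set P W), W) \<in> composable S"
proof -
  obtain p where "p \<in> range_set P W"
    using ne by blast
  then show "up (range_set P W) \<in> unit_set S"
    using unit_setI[OF UF_range[OF W ne], of p] up_incl by (auto simp: range_set_def)
  have "e * w \<noteq> 0" if e: "e \<in> up (range_set P W)" and w: "w \<in> W" for e w
  proof -
    obtain q where q: "q \<in> range_set P W" "q \<preceq> e"
      using e unfolding mem_up by blast
    then have "q * w \<in> W"
      using w range_set_iff[OF W] by blast
    moreover have "q * w \<preceq> e * w"
      using mult_mono_below[OF q(2) below_refl] .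
    ultimately show ?thesis
      using UF_zero[OF W] below_zero by auto
  qed
  then show "(up (range_set P W), W) \<in> composable S"
    using W UF_range[OF W ne] by (simp add: composable_S zero_notin_times)
qed

text \<open>A range unit \<open>u\<close> composes with \<open>W\<close>, and then the source of any
  member of \<open>u\<close> is a projection in \<open>range_set P W\<close>. Conversely a nonempty
  \<open>range_set P W\<close> generates a range unit.\<close>

lemma has_range_unit_iff:
  assumes W: "W \<in> UF"
  shows "has_range_unit S W \<longleftrightarrow> range_set P W \<noteq> {}"
proof
  assume "has_range_unit S W"
  then obtain u where u: "u \<in> UF" "(u, W) \<in> composable S"
    by (auto simp: has_range_unit_def unit_set_def)
  then show "range_set P W \<noteq> {}"
    using composable_iff[OF u(1) W] UF_nonempty[OF u(1)] by (auto simp: composable_S)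
next
  assume "range_set P W \<noteq> {}"
  then show "has_range_unit S W"
    using range_is_unit[OF W] by (auto simp: has_range_unit_def)
qed

lemma range_unit_eq:
  assumes "W \<in> UF" "range_set P W \<noteq> {}"
  shows "range_unit S W = up (range_set P W)"
  unfolding range_unit_def
proof (rule the_equality)
  fix u assume "u \<in> unit_set S \<and> (u, W) \<in> composable S"
  then show "u = up (range_set P W)"
    using range_unit_unique range_is_unit[OF assms] by metis
qed (simp add: range_is_unit[OF assms])

text \<open>Composability puts every \<open>src a\<close> into \<open>range_set P W\<close>, so the
  source ultrafilter is contained in the range ultrafilter and they coincide. If they coincide,
  \<open>src a\<close> lies above a projection fixing some element of \<open>W\<close>, and fixes
  that element too.\<close>

lemma composable_iff_units:
  assumes A: "A \<in> UF" and W: "W \<in> UF"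
  shows "(A, W) \<in> composable S \<longleftrightarrow> has_range_unit S W \<and> source_unit S A = range_unit S W"
proof
  assume "(A, W) \<in> composable S"
  then have R: "\<forall>a\<in>A. src a \<in> range_set P W"
    using composable_iff[OF A W] by (simp add: composable_S)
  then have ne: "range_set P W \<noteq> {}"
    using UF_nonempty A by blast
  have "up (src ` A) \<subseteq> up (range_set P W)"
    using R unfolding subset_iff mem_up by blast
  then have "up (src ` A) = up (range_set P W)"
    using UF_subset_eq UF_source[OF A] UF_range[OF W ne] by blast
  then show "has_range_unit S W \<and> source_unit S A = range_unit S W"
    using source_unit_eq[OF A] range_unit_eq[OF W ne] has_range_unit_iff[OF W] ne by simp
next
  assume h: "has_range_unit S W \<and> source_unit S A = range_unit S W"
  then have eq: "up (src ` A) = up (range_set P W)"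
    using source_unit_eq[OF A] range_unit_eq[OF W] has_range_unit_iff[OF W] by simp
  have "src a \<in> range_set P W" if "a \<in> A" for a
  proof -
    have "src a \<in> up (range_set P W)"
      using eq that up_incl[of "src a" "src ` A"] by blast
    then obtain p w where "p \<in> P" "p \<preceq> src a" "w \<in> W" "p * w = w"
      unfolding mem_up range_set_def by blast
    then show ?thesis
      using proj_above_fixes[of p "src a" w] unfolding range_set_def by auto
  qed
  then show "(A, W) \<in> composable S"
    using composable_iff[OF A W] A W by (simp add: composable_S)
qed

lemma semicategory_S: "semicategory S"
proof
  show "has_source_unit S a" if "a \<in> carrier S" for a
    using source_is_unit that by (auto simp: has_source_unit_def)
  show "composable S =
      {(a, b) \<in> carrier S \<times> carrier S. has_range_unit S b \<and> source_unit S a = range_unit S b}"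
    using composable_iff_units composable_S by auto
qed

section \<open>The topology on ultrafilters\<close>

abbreviation X :: "'a set topology" where
  "X \<equiv> ultrafilter_topology (restr_order P)"

abbreviation Bas :: "'a \<Rightarrow> 'a set set" where
  "Bas \<equiv> basic_ultrafilters (restr_order P)"

section \<open>Basic open sets, separation and compactness\<close>

lemma mem_Bas: "U \<in> Bas b \<longleftrightarrow> U \<in> UF \<and> b \<in> U"
  by (simp add: basic_ultrafilters_def)

lemma openin_Bas [simp]: "openin X (Bas b)"
  unfolding openin_ultrafilter_topology by (intro arbitrary_union_of_inc) auto

lemma openin_X_iff: "openin X W \<longleftrightarrow> W \<subseteq> UF \<and> (\<forall>U\<in>W. \<exists>b\<in>U. Bas b \<subseteq> W)"
proof
  assume W: "openin X W"
  show "W \<subseteq> UF \<and> (\<forall>U\<in>W. \<exists>b\<in>U. Bas b \<subseteq> W)"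
  proof (intro conjI ballI)
    show "W \<subseteq> UF"
      using openin_subset[OF W] by simp
    fix U assume U: "U \<in> W"
    have "(arbitrary union_of (\<lambda>W. \<exists>b\<in>carrier (restr_order P). W = Bas b)) W"
      using W unfolding openin_ultrafilter_topology .
    then obtain b where "U \<in> Bas b" "Bas b \<subseteq> W"
      using U unfolding arbitrary_union_of_alt by blast
    then show "\<exists>b\<in>U. Bas b \<subseteq> W"
      using mem_Bas by blast
  qed
next
  assume "W \<subseteq> UF \<and> (\<forall>U\<in>W. \<exists>b\<in>U. Bas b \<subseteq> W)"
  then show "openin X W"
    by (subst openin_subopen) (metis mem_Bas openin_Bas subsetD)
qed

text \<open>An element \<open>b\<close> of \<open>V\<close> outside \<open>U\<close> is disjoint
  from some \<open>y\<close> in \<open>U\<close>. No ultrafilter contains two disjoint elements, so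
  \<open>Bas y\<close> and \<open>Bas b\<close> separate the points.\<close>

lemma Hausdorff_X: "Hausdorff_space X"
  unfolding Hausdorff_space_def
proof (intro allI impI)
  fix U V assume "U \<in> topspace X \<and> V \<in> topspace X \<and> U \<noteq> V"
  then have UV: "U \<in> UF" "V \<in> UF" "U \<noteq> V"
    by auto
  then obtain b where b: "b \<in> V" "b \<notin> U"
    using UF_subset_eq[of V U] by blast
  obtain a where "a \<in> U"
    using UF_nonempty UV(1) by blast
  then obtain y where y: "y \<in> U" "disjnt_below y b"
    using UF_disjnt[OF UV(1) b(2)] by metis
  have "disjnt (Bas y) (Bas b)"
    using UF_not_disjnt y(2) unfolding disjnt_iff mem_Bas by blast
  then show "\<exists>G H. openin X G \<and> openin X H \<and> U \<in> G \<and> V \<in> H \<and> disjnt G H"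
    using UV b y openin_Bas mem_Bas by metis
qed

lemma compactin_Bas: "compactin X (Bas b)"
  unfolding compactin_def
proof (intro conjI allI impI)
  show "Bas b \<subseteq> topspace X"
    using mem_Bas by auto
  fix \<U> assume \<U>: "Ball \<U> (openin X) \<and> Bas b \<subseteq> \<Union>\<U>"
  define cov where "cov = (\<lambda>x. \<exists>\<F>. finite \<F> \<and> \<F> \<subseteq> \<U> \<and> Bas x \<subseteq> \<Union>\<F>)"
  \<comment> \<open>Complements in the Boolean algebra below \<open>b\<close>, written with both
    maximality clauses so that the relation is symmetric and primeness applies to either
    side.\<close>
  define compl where "compl = (\<lambda>x y. x \<preceq> b \<and> y \<preceq> b \<and> disjnt_below x y \<and>
    (\<forall>z. z \<preceq> b \<longrightarrow> disjnt_below z x \<longrightarrow> z \<preceq> y) \<and>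
    (\<forall>z. z \<preceq> b \<longrightarrow> disjnt_below z y \<longrightarrow> z \<preceq> x))"
  let ?T = "{y. \<exists>x. cov x \<and> compl x y}"
  have ex_compl: "\<exists>y. compl x y" if "x \<preceq> b" for x
    using ex_complement[OF that] that unfolding compl_def by metis
  have compl_sym: "compl y x" if "compl x y" for x y
    using that disjnt_below_sym unfolding compl_def by blast
  have prime: "y \<in> U" if "compl x y" "U \<in> UF" "b \<in> U" "x \<notin> U" for x y U
    using UF_prime[OF that(2-4)] that(1) unfolding compl_def by blast
  \<comment> \<open>Otherwise the complements in \<open>b\<close> of finitely covered elements generate a proper filter, and no
    ultrafilter containing them is covered.\<close>
  have cov_b: "cov b"
  proof (rule ccontr)
    assume nb: "\<not> cov b"
    have cov0: "cov 0"
      unfolding cov_def using mem_Bas UF_zero by (intro exI[of _ "{}"]) blast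
    have "filt (up ?T)"
    proof (rule filt_upI)
      show "?T \<noteq> {}"
        using ex_compl[OF zero_below] cov0 by blast
      fix y1 y2 assume "y1 \<in> ?T" "y2 \<in> ?T"
      then obtain x1 x2 where x: "cov x1" "cov x2" "compl x1 y1" "compl x2 y2"
        by blast
      obtain y where y: "y \<preceq> y1" "y \<preceq> y2" "\<And>c. \<lbrakk>c \<preceq> y1; c \<preceq> y2\<rbrakk> \<Longrightarrow> c \<preceq> y"
        using ex_meet by blast
      have yb: "y \<preceq> b"
        using below_trans[OF y(1), of b] x(3) unfolding compl_def by blast
      \<comment> \<open>As \<open>y\<close> is the meet of \<open>y1\<close> and \<open>y2\<close>,
        its complement \<open>x\<close> is in effect the join of \<open>x1\<close> and
        \<open>x2\<close>; primeness yields the inclusion of basic sets without forming that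
        join.\<close>
      obtain x where xy: "compl x y"
        using ex_compl[OF yb] compl_sym by blast
      have "Bas x \<subseteq> Bas x1 \<union> Bas x2"
      proof
        fix U assume "U \<in> Bas x"
        then have U: "U \<in> UF" "x \<in> U"
          by (simp_all add: mem_Bas)
        then have bU: "b \<in> U"
          using UF_up xy unfolding compl_def by blast
        have "x1 \<in> U \<or> x2 \<in> U"
        proof (rule ccontr)
          assume "\<not> (x1 \<in> U \<or> x2 \<in> U)"
          then have "y1 \<in> U" "y2 \<in> U"
            using prime x(3,4) U bU by blast+
          then have "y \<in> U"
            using UF_lower[OF U(1)] UF_up[OF U(1)] y(3) by metis
          then show False
            using UF_not_disjnt U xy unfolding compl_def by blast
        qed
        then show "U \<in> Bas x1 \<union> Bas x2"
          using U by (simp add: mem_Bas)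
      qed
      moreover obtain F1 F2 where "finite F1" "F1 \<subseteq> \<U>" "Bas x1 \<subseteq> \<Union>F1"
        "finite F2" "F2 \<subseteq> \<U>" "Bas x2 \<subseteq> \<Union>F2"
        using x(1,2) unfolding cov_def by blast
      ultimately have "cov x"
        unfolding cov_def by (intro exI[of _ "F1 \<union> F2"]) auto
      then show "\<exists>c\<in>?T. c \<preceq> y1 \<and> c \<preceq> y2"
        using xy y by blast
    qed
    moreover have "0 \<notin> up ?T"
    proof
      assume "0 \<in> up ?T"
      then obtain x where x: "cov x" "compl x 0"
        by (auto simp: mem_up below_zero)
      \<comment> \<open>Everything is disjoint from \<open>0\<close>, so a complement
        \<open>x\<close> of \<open>0\<close> lies above \<open>b\<close>, and a finite cover of
        \<open>Bas x\<close> would cover \<open>Bas b\<close>.\<close>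
      have "disjnt_below b 0"
        by (simp add: disjnt_below_def below_zero)
      then have "b \<preceq> x"
        using x(2) below_refl unfolding compl_def by blast
      then have "Bas b \<subseteq> Bas x"
        using UF_up mem_Bas by blast
      then show False
        using x(1) nb unfolding cov_def by (meson subset_trans)
    qed
    ultimately obtain U where U: "U \<in> UF" "up ?T \<subseteq> U"
      using UF_extend by blast
    have bT: "b \<in> up ?T"
      using ex_compl[OF zero_below] cov0 unfolding mem_up compl_def by blast
    then have bU: "b \<in> U"
      using U by blast
    then obtain G where G: "G \<in> \<U>" "U \<in> G"
      using \<U> U mem_Bas by blast
    then obtain c where c: "c \<in> U" "Bas c \<subseteq> G"
      using \<U> openin_X_iff by metis
    \<comment> \<open>A single set \<open>G\<close> of the cover contains \<open>Bas d\<close>, so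
      the complement of \<open>d\<close> belongs to \<open>?T\<close> and hence to \<open>U\<close>,
      which cannot contain it together with \<open>d\<close>.\<close>
    obtain d where d: "d \<in> U" "d \<preceq> b" "d \<preceq> c"
      using UF_lower U bU c by metis
    have "Bas d \<subseteq> G"
      using c(2) d(3) UF_up mem_Bas by blast
    then have "cov d"
      unfolding cov_def using G by (intro exI[of _ "{G}"]) auto
    moreover obtain y where y: "compl d y"
      using ex_compl d by blast
    ultimately have "y \<in> ?T"
      by blast
    then have "y \<in> U"
      using U(2) up_incl[of y ?T] by blast
    moreover have "disjnt_below d y"
      using y unfolding compl_def by blast
    ultimately show False
      using UF_not_disjnt[OF U(1) d(1)] by blast
  qed
  then show "\<exists>\<F>. finite \<F> \<and> \<F> \<subseteq> \<U> \<and> Bas b \<subseteq> \<Union>\<F>"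
    by (simp add: cov_def)
qed

section \<open>Continuity of source, range and product\<close>

lemma ranged_S: "U \<in> ranged_elements S \<longleftrightarrow> U \<in> UF \<and> range_set P U \<noteq> {}"
  using has_range_unit_iff by (auto simp: ranged_elements_def)

lemma openin_ranged_S: "openin X (ranged_elements S)"
  unfolding openin_X_iff
proof (intro conjI ballI)
  show "ranged_elements S \<subseteq> UF"
    using ranged_S by blast
  fix U assume "U \<in> ranged_elements S"
  then obtain p a where "p \<in> P" "a \<in> U" "p * a = a"
    unfolding ranged_S range_set_def by blast
  then show "\<exists>a\<in>U. Bas a \<subseteq> ranged_elements S"
    unfolding subset_iff ranged_S range_set_def mem_Bas by blast
qed

text \<open>Continuity into a space with basis \<open>Bas b\<close> is local persistence of
  memberships. Source, range and product satisfy it because a membership in their values has a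
  witness consisting of finitely many elements, which works throughout a basic
  neighbourhood.\<close>

lemma continuous_map_XI:
  assumes "\<And>U. U \<in> topspace T \<Longrightarrow> f U \<in> UF"
    and "\<And>U b. \<lbrakk>U \<in> topspace T; b \<in> f U\<rbrakk>
      \<Longrightarrow> \<exists>G. openin T G \<and> U \<in> G \<and> (\<forall>V\<in>G. b \<in> f V)"
  shows "continuous_map T X f"
  unfolding continuous_map_def
proof (intro conjI allI impI)
  show "f \<in> topspace T \<rightarrow> topspace X"
    using assms(1) by simp
  fix W assume W: "openin X W"
  show "openin T {U \<in> topspace T. f U \<in> W}"
  proof (subst openin_subopen, intro ballI)
    fix U assume "U \<in> {U \<in> topspace T. f U \<in> W}"
    then have U: "U \<in> topspace T" "f U \<in> W"
      by auto
    then obtain b where b: "b \<in> f U" "Bas b \<subseteq> W"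
      using W unfolding openin_X_iff by blast
    then obtain G where G: "openin T G" "U \<in> G" "\<forall>V\<in>G. b \<in> f V"
      using assms(2)[OF U(1) b(1)] by blast
    have "f V \<in> W" if V: "V \<in> G" for V
    proof -
      have "V \<in> topspace T"
        using openin_subset[OF G(1)] V by blast
      then have "f V \<in> Bas b"
        using assms(1) G(3) V by (simp add: mem_Bas)
      then show ?thesis
        using b(2) by blast
    qed
    then show "\<exists>G. openin T G \<and> U \<in> G \<and> G \<subseteq> {U \<in> topspace T. f U \<in> W}"
      using G openin_subset[OF G(1)] by blast
  qed
qed

lemma continuous_source_S: "continuous_map X X (source_unit S)"
proof (rule continuous_map_XI)
  show "source_unit S U \<in> UF" if "U \<in> topspace X" for U
    using that source_unit_eq UF_source by simp
  fix U b assume "U \<in> topspace X" "b \<in> source_unit S U"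
  then obtain a where a: "U \<in> UF" "a \<in> U" "src a \<preceq> b"
    by (auto simp: source_unit_eq mem_up)
  have "b \<in> source_unit S V" if "V \<in> Bas a" for V
    using that a(3) by (auto simp: mem_Bas source_unit_eq mem_up)
  moreover have "U \<in> Bas a"
    using a by (simp add: mem_Bas)
  ultimately show "\<exists>G. openin X G \<and> U \<in> G \<and> (\<forall>V\<in>G. b \<in> source_unit S V)"
    using openin_Bas by blast
qed

lemma continuous_range_S:
  "continuous_map (subtopology X (ranged_elements S)) X (range_unit S)"
proof (rule continuous_map_XI)
  let ?T = "subtopology X (ranged_elements S)"
  have top: "topspace ?T = ranged_elements S"
    using ranged_S by auto
  show "range_unit S U \<in> UF" if "U \<in> topspace ?T" for U
    using that range_unit_eq UF_range unfolding top ranged_S by simp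
  fix U b assume U: "U \<in> topspace ?T" "b \<in> range_unit S U"
  then obtain p a where a: "a \<in> U" "p \<in> P" "p * a = a" "p \<preceq> b"
    unfolding top ranged_S by (auto simp: range_unit_eq mem_up range_set_def)
  have "b \<in> range_unit S V" if V: "V \<in> ranged_elements S \<inter> Bas a" for V
  proof -
    have "p \<in> range_set P V"
      using V a by (auto simp: mem_Bas range_set_def)
    then show ?thesis
      using V a(4) range_unit_eq by (auto simp: ranged_S mem_up)
  qed
  moreover have "openin ?T (ranged_elements S \<inter> Bas a)"
    by (simp add: openin_subtopology_Int2)
  moreover have "U \<in> ranged_elements S \<inter> Bas a"
    using U a unfolding top ranged_S by (simp add: mem_Bas ranged_S)
  ultimately show "\<exists>G. openin ?T G \<and> U \<in> G \<and> (\<forall>V\<in>G. b \<in> range_unit S V)"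
    by blast
qed

lemma continuous_comp_S:
  "continuous_map (subtopology (prod_topology X X) (composable S)) X (\<lambda>(a, b). a \<cdot>\<^bsub>S\<^esub> b)"
proof (rule continuous_map_XI)
  let ?T = "subtopology (prod_topology X X) (composable S)"
  have top: "topspace ?T = composable S"
    using composable_S by auto
  show "(case U of (a, b) \<Rightarrow> a \<cdot>\<^bsub>S\<^esub> b) \<in> UF" if "U \<in> topspace ?T" for U
    using that UF_times unfolding top by (cases U) (auto simp: composable_S pprod_S)
  fix U c assume U: "U \<in> topspace ?T" "c \<in> (case U of (a, b) \<Rightarrow> a \<cdot>\<^bsub>S\<^esub> b)"
  obtain V W where VW: "U = (V, W)"
    by (cases U)
  have VWc: "(V, W) \<in> composable S"
    using U(1) VW unfolding top by simp
  obtain v w where vw: "v \<in> V" "w \<in> W" "v * w \<preceq> c"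
    using U(2) VW by (auto simp: pprod_S mem_up elim!: set_times_elim)
  have "c \<in> (case U of (a, b) \<Rightarrow> a \<cdot>\<^bsub>S\<^esub> b)" if "U \<in> composable S \<inter> Bas v \<times> Bas w" for U
    using that vw(3) by (auto simp: pprod_S mem_up mem_Bas intro!: bexI[of _ "v * w"])
  moreover have "openin ?T (composable S \<inter> Bas v \<times> Bas w)"
    by (intro openin_subtopology_Int2) (simp add: openin_prod_Times_iff)
  moreover have "U \<in> composable S \<inter> Bas v \<times> Bas w"
    using VW VWc vw by (simp add: mem_Bas composable_S)
  ultimately show "\<exists>G. openin ?T G \<and> U \<in> G \<and> (\<forall>U\<in>G. c \<in> (case U of (a, b) \<Rightarrow> a \<cdot>\<^bsub>S\<^esub> b))"
    by blast
qed

section \<open>The source map is locally injective and open\<close>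

lemma source_subset:
  assumes U: "U \<in> UF" and V: "V \<in> UF" and a: "a \<in> U" "a \<in> V"
    and eq: "up (src ` U) = up (src ` V)"
  shows "U \<subseteq> V"
proof
  fix c assume c: "c \<in> U"
  obtain d where d: "d \<in> U" "d \<preceq> a" "d \<preceq> c"
    using UF_lower[OF U a(1) c] by metis
  then obtain b where b: "b \<in> V" "src b \<preceq> src d"
    using up_incl[of "src d" "src ` U"] unfolding eq mem_up by blast
  obtain e where e: "e \<in> V" "e \<preceq> a" "e \<preceq> b"
    using UF_lower[OF V a(2) b(1)] by metis
  \<comment> \<open>Below \<open>a\<close> an element equals \<open>a\<close> times its source, so
    comparing the sources of \<open>e\<close> and \<open>d\<close> compares the elements
    themselves.\<close>
  have "a * src e \<preceq> a * src d"
    using mult_mono_below[OF below_refl below_trans[OF src_mono[OF e(3)] b(2)]] .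
  then have "e \<preceq> d"
    using below_eq_mult_src[OF e(2)] below_eq_mult_src[OF d(2)] by simp
  then show "c \<in> V"
    using UF_up[OF V e(1)] below_trans[OF _ d(3)] by blast
qed

lemma inj_on_source_Bas: "inj_on (source_unit S) (Bas a)"
proof (rule inj_onI)
  fix U V assume "U \<in> Bas a" "V \<in> Bas a" "source_unit S U = source_unit S V"
  then show "U = V"
    using source_subset[of U V a] UF_subset_eq[of U V] by (simp add: mem_Bas source_unit_eq)
qed

lemma source_image_Bas: "source_unit S ` Bas a = Bas (src a)"
proof
  show "source_unit S ` Bas a \<subseteq> Bas (src a)"
    using UF_source up_incl by (force simp: mem_Bas source_unit_eq)
  show "Bas (src a) \<subseteq> source_unit S ` Bas a"
  proof
    fix E assume "E \<in> Bas (src a)"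
    then have E: "E \<in> UF" "src a \<in> E"
      by (simp_all add: mem_Bas)
    \<comment> \<open>Every member of \<open>E\<close> has one below it that is also below
      \<open>src a\<close>, and such a projection \<open>e'\<close> is the source of
      \<open>a * e'\<close>. This keeps the products \<open>a * e\<close> nonzero and lets
      \<open>E\<close> be recovered from sources.\<close>
    have lower: "\<exists>e'\<in>E. e' \<preceq> e \<and> src (a * e') = e'" if e: "e \<in> E" for e
    proof -
      obtain e' where e': "e' \<in> E" "e' \<preceq> src a" "e' \<preceq> e"
        using UF_lower[OF E e] .
      then have "e' \<in> P"
        using proj_down src_proj by blast
      then show ?thesis
        using e' src_mult_proj proj_below_iff[OF _ src_proj] by metis
    qed
    have nz: "a * e \<noteq> 0" if e: "e \<in> E" for e
    proof
      assume "a * e = 0"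
      obtain e' where e': "e' \<in> E" "e' \<preceq> e" "src (a * e') = e'"
        using lower[OF e] by blast
      have "a * e' = 0"
        using mult_mono_below[OF below_refl[of a] e'(2)] \<open>a * e = 0\<close> below_zero by simp
      then show False
        using e' UF_zero[OF E(1)] src_eq_0_iff by metis
    qed
    \<comment> \<open>The preimage of \<open>E\<close> under the source map; it contains
      \<open>a\<close> because \<open>a * src a = a\<close>.\<close>
    define A where "A = up ((*) a ` E)"
    have A: "A \<in> UF"
      unfolding A_def using UF_translate[OF E(1) nz] .
    have "a * src a \<in> A"
      unfolding A_def by (rule up_incl[OF imageI[OF E(2)]])
    then have "A \<in> Bas a"
      using A by (simp add: mem_Bas)
    moreover have "E \<subseteq> up (src ` A)"
    proof
      fix e assume "e \<in> E"
      then obtain e' where e': "e' \<in> E" "e' \<preceq> e" "src (a * e') = e'"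
        using lower by blast
      then have "a * e' \<in> A"
        unfolding A_def by (intro up_incl imageI)
      then have "e' \<in> src ` A"
        using e'(3) by (metis imageI)
      then show "e \<in> up (src ` A)"
        using e'(2) unfolding mem_up by blast
    qed
    then have "E = source_unit S A"
      using UF_subset_eq[OF E(1) UF_source[OF A]] source_unit_eq[OF A] by simp
    ultimately show "E \<in> source_unit S ` Bas a"
      by blast
  qed
qed

lemma open_source_S: "open_map X X (source_unit S)"
  unfolding open_map_def
proof (intro allI impI)
  fix W assume "openin X W"
  then have W: "W \<subseteq> UF" "\<forall>U\<in>W. \<exists>b\<in>U. Bas b \<subseteq> W"
    by (auto simp: openin_X_iff)
  show "openin X (source_unit S ` W)"
  proof (subst openin_subopen, intro ballI)
    fix E assume "E \<in> source_unit S ` W"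
    then obtain U b where U: "U \<in> W" "E = source_unit S U" "b \<in> U" "Bas b \<subseteq> W"
      using W by blast
    then have "E \<in> Bas (src b)" "Bas (src b) \<subseteq> source_unit S ` W"
      using W(1) mem_Bas unfolding source_image_Bas[symmetric] by blast+
    then show "\<exists>G. openin X G \<and> E \<in> G \<and> G \<subseteq> source_unit S ` W"
      using openin_Bas by blast
  qed
qed

section \<open>Closedness of composability and the basis of compact open sets\<close>

lemma closedin_composable_S: "closedin (prod_topology X X) (composable S)"
  unfolding closedin_def
proof
  show "composable S \<subseteq> topspace (prod_topology X X)"
    using composable_S by auto
  show "openin (prod_topology X X) (topspace (prod_topology X X) - composable S)"
  proof (subst openin_subopen, intro ballI)
    fix Z assume Z: "Z \<in> topspace (prod_topology X X) - composable S"
    obtain V W where VW: "Z = (V, W)"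
      by (cases Z)
    then obtain v w where vw: "V \<in> UF" "W \<in> UF" "v \<in> V" "w \<in> W" "v * w = 0"
      using Z by (auto simp: composable_S zero_notin_times)
    have "Bas v \<times> Bas w \<subseteq> topspace (prod_topology X X) - composable S"
      using vw(5) by (auto simp: mem_Bas composable_S zero_notin_times)
    moreover have "openin (prod_topology X X) (Bas v \<times> Bas w)"
      by (simp add: openin_prod_Times_iff)
    moreover have "Z \<in> Bas v \<times> Bas w"
      using VW vw by (simp add: mem_Bas)
    ultimately show "\<exists>G. openin (prod_topology X X) G \<and> Z \<in> G \<and>
        G \<subseteq> topspace (prod_topology X X) - composable S"
      by blast
  qed
qed

lemma compact_open_base_X: "openin X = arbitrary union_of (\<lambda>K. compactin X K \<and> openin X K)"
proof (rule ext, rule iffI)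
  fix W assume "openin X W"
  then show "(arbitrary union_of (\<lambda>K. compactin X K \<and> openin X K)) W"
    unfolding arbitrary_union_of_alt openin_X_iff[of W]
    using compactin_Bas openin_Bas mem_Bas by (metis subsetD)
next
  fix W assume "(arbitrary union_of (\<lambda>K. compactin X K \<and> openin X K)) W"
  then show "openin X W"
    unfolding arbitrary_union_of_alt by (subst openin_subopen) blast
qed

lemma ample_S: "ample_semicategory S X"
proof -
  interpret semicategory S
    by (rule semicategory_S)
  show ?thesis
  proof
    show "topspace X = carrier S"
      by simp
    show "\<exists>W. openin X W \<and> U \<in> W \<and> inj_on (source_unit S) W" if U: "U \<in> carrier S" for U
    proof -
      obtain a where "a \<in> U"
        using UF_nonempty U by auto
      then show ?thesis
        using U inj_on_source_Bas openin_Bas mem_Bas by (metis carrier_S)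
    qed
  qed (fact continuous_source_S continuous_range_S continuous_comp_S openin_ranged_S
      open_source_S closedin_composable_S compact_open_base_X)+
qed

end

theorem theorem6p5:
  fixes P :: "'a::{semigroup_mult, zero} set"
  assumes "semi_boolean_restriction_semigroup P"
  shows "Hausdorff_space (ultrafilter_topology (restr_order P)) \<and>
    ample_semicategory (ultrafilter_semicategory P) (ultrafilter_topology (restr_order P)) \<and>
    (\<forall>U \<in> ultrafilters (restr_order P).
       source_unit (ultrafilter_semicategory P) U
         = up_closure (restr_order P) (source_set P U) \<and>
       (has_range_unit (ultrafilter_semicategory P) U \<longleftrightarrow> range_set P U \<noteq> {}) \<and>
       (range_set P U \<noteq> {} \<longrightarrow>
          range_unit (ultrafilter_semicategory P) U
            = up_closure (restr_order P) (range_set P U)))"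
  proof -
  interpret semi_boolean_restriction_semigroup P
    by fact
  show ?thesis
    using Hausdorff_X ample_S source_unit_eq up_source_set has_range_unit_iff range_unit_eq
    by simp
qed

end
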